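(* Fix an ellipse (the elliptic billiard) $\frac{x^2}{a^2}+\frac{y^2}{b^2}=1$ with $a>b>0$. For each 3-periodic triangle $T$ of this billiard, let $r$ and $R$ be the inradius and circumradius of $T$, $\rho=r/R$, $d=\sqrt{R(R-2r)}$, and let $I_3'$ be the inconic of the excentral triangle $T'$ of $T$ centered at the circumcenter of $T'$; it is an ellipse, with major and minor semiaxis lengths $\mu_3'$ and $\mu_3$. Then, over the family of all 3-periodics of the billiard, $\mu_3'$ and $\mu_3$ are variable (neither is constant), but their ratio $\mu_3'/\mu_3$ is invariant (takes the same value for every 3-periodic of the billiard). Moreover, for every 3-periodic, $$\mu_3'=R+d,\qquad \mu_3=R-d,\qquad \frac{\mu_3'}{\mu_3}=\frac{R+d}{R-d}=\frac{1+\sqrt{1-2\rho}}{\rho}-1>1 .$$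
   Context: A 3-periodic of the elliptic billiard is a (non-degenerate) triangle inscribed in the ellipse such that at each vertex the normal to the ellipse is the internal angle bisector of the triangle, i.e. a closed billiard trajectory with three elastic bounces; these form a one-parameter family. The excentral triangle $T'$ of $T$ has as vertices the three excenters of $T$. An inconic of a triangle is a conic tangent to its three sidelines; it is determined here by its center. The circumcenter of $T'$ is the Bevan point $X_{40}$ of $T$. *)

theory Defs
  imports "HOL-Analysis.Analysis"
begin

type_synonym point = "real^2"
type_synonym triangle = "point \<times> point \<times> point"

definition line_dir :: "point \<Rightarrow> point \<Rightarrow> point set" where
  "line_dir P v = {P + t *\<^sub>R v | t. True}"

definition sideline :: "point \<Rightarrow> point \<Rightarrow> point set" where
  "sideline A B = affine hull {A, B}"

text \<open>Bisectors of the angle \<open>Q P S\<close> at the vertex \<open>P\<close>: \<open>sgn v\<close> is the unit vector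
  in direction \<open>v\<close>, so the sum of the two unit vectors along the sides directs the internal
  bisector and their difference directs the external one.\<close>

definition internal_bisector :: "point \<Rightarrow> point \<Rightarrow> point \<Rightarrow> point set" where
  "internal_bisector P Q S = line_dir P (sgn (Q - P) + sgn (S - P))"

definition external_bisector :: "point \<Rightarrow> point \<Rightarrow> point \<Rightarrow> point set" where
  "external_bisector P Q S = line_dir P (sgn (Q - P) - sgn (S - P))"

fun circumcenter :: "triangle \<Rightarrow> point" where
  "circumcenter (A, B, C) = (THE X. dist X A = dist X B \<and> dist X B = dist X C)"

fun circumradius :: "triangle \<Rightarrow> real" where
  "circumradius (A, B, C) = dist (circumcenter (A, B, C)) A"

fun incenter :: "triangle \<Rightarrow> point" where
  "incenter (A, B, C) =
     (THE X. X \<in> internal_bisector A B C \<and> X \<in> internal_bisector B C A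
           \<and> X \<in> internal_bisector C A B)"

text \<open>The incenter has the same distance from all three sidelines.\<close>

fun inradius :: "triangle \<Rightarrow> real" where
  "inradius (A, B, C) = infdist (incenter (A, B, C)) (sideline A B)"

text \<open>The excenter opposite to the first vertex.\<close>

definition excenter :: "point \<Rightarrow> point \<Rightarrow> point \<Rightarrow> point" where
  "excenter A B C =
     (THE X. X \<in> internal_bisector A B C \<and> X \<in> external_bisector B C A
           \<and> X \<in> external_bisector C A B)"

fun excentral :: "triangle \<Rightarrow> triangle" where
  "excentral (A, B, C) = (excenter A B C, excenter B C A, excenter C A B)"

definition billiard_ellipse :: "real \<Rightarrow> real \<Rightarrow> point set" where
  "billiard_ellipse a b = {P. (P$1)\<^sup>2 / a\<^sup>2 + (P$2)\<^sup>2 / b\<^sup>2 = 1}"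

text \<open>The direction is half the gradient of the defining function of the ellipse.\<close>

definition ellipse_normal :: "real \<Rightarrow> real \<Rightarrow> point \<Rightarrow> point set" where
  "ellipse_normal a b P = line_dir P (vector [P$1 / a\<^sup>2, P$2 / b\<^sup>2])"

definition three_periodics :: "real \<Rightarrow> real \<Rightarrow> triangle set" where
  "three_periodics a b =
     {(A, B, C) | A B C.
        \<not> collinear {A, B, C} \<and> {A, B, C} \<subseteq> billiard_ellipse a b
        \<and> ellipse_normal a b A = internal_bisector A B C
        \<and> ellipse_normal a b B = internal_bisector B C A
        \<and> ellipse_normal a b C = internal_bisector C A B}"

text \<open>A conic is given by a symmetric matrix in the homogeneous coordinates \<open>(x, y, 1)\<close>;
  it is nondegenerate if the determinant is nonzero. The tangent line at one of its points is the
  polar of that point; the center is the (finite) pole of the line at infinity, equivalently the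
  point where the gradient of the quadratic polynomial vanishes.\<close>

definition hom_coords :: "point \<Rightarrow> real^3" where
  "hom_coords P = vector [P$1, P$2, 1]"

definition conic :: "real^3^3 \<Rightarrow> point set" where
  "conic M = {P. hom_coords P \<bullet> (M *v hom_coords P) = 0}"

definition polar_line :: "real^3^3 \<Rightarrow> point \<Rightarrow> point set" where
  "polar_line M P = {X. hom_coords X \<bullet> (M *v hom_coords P) = 0}"

definition tangent_to_conic :: "point set \<Rightarrow> real^3^3 \<Rightarrow> bool" where
  "tangent_to_conic l M \<longleftrightarrow> (\<exists>P \<in> conic M. l = polar_line M P)"

definition conic_center :: "real^3^3 \<Rightarrow> point \<Rightarrow> bool" where
  "conic_center M c \<longleftrightarrow> (M *v hom_coords c)$1 = 0 \<and> (M *v hom_coords c)$2 = 0"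

fun is_inconic :: "triangle \<Rightarrow> point \<Rightarrow> point set \<Rightarrow> bool" where
  "is_inconic (A, B, C) c K \<longleftrightarrow>
     (\<exists>M. transpose M = M \<and> det M \<noteq> 0 \<and> K = conic M \<and> conic_center M c
        \<and> tangent_to_conic (sideline A B) M
        \<and> tangent_to_conic (sideline B C) M
        \<and> tangent_to_conic (sideline C A) M)"

definition inconic :: "triangle \<Rightarrow> point \<Rightarrow> point set" where
  "inconic T c = (THE K. is_inconic T c K)"

text \<open>\<open>p\<close> and \<open>q\<close> are the major and minor semiaxis lengths; circles (\<open>p = q\<close>) are included.\<close>

definition ellipse_with_semiaxes :: "real \<Rightarrow> real \<Rightarrow> point set \<Rightarrow> bool" where
  "ellipse_with_semiaxes p q K \<longleftrightarrow> 0 < q \<and> q \<le> p \<and>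
     (\<exists>c u v. norm u = 1 \<and> norm v = 1 \<and> u \<bullet> v = 0
        \<and> K = {X. ((X - c) \<bullet> u)\<^sup>2 / p\<^sup>2 + ((X - c) \<bullet> v)\<^sup>2 / q\<^sup>2 = 1})"

definition is_ellipse :: "point set \<Rightarrow> bool" where
  "is_ellipse K \<longleftrightarrow> (\<exists>p q. ellipse_with_semiaxes p q K)"

definition major_semiaxis :: "point set \<Rightarrow> real" where
  "major_semiaxis K = (THE p. \<exists>q. ellipse_with_semiaxes p q K)"

definition minor_semiaxis :: "point set \<Rightarrow> real" where
  "minor_semiaxis K = (THE q. \<exists>p. ellipse_with_semiaxes p q K)"

definition excentral_inconic :: "triangle \<Rightarrow> point set" where
  "excentral_inconic T = inconic (excentral T) (circumcenter (excentral T))"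

definition mu_major :: "triangle \<Rightarrow> real" where
  "mu_major T = major_semiaxis (excentral_inconic T)"

definition mu_minor :: "triangle \<Rightarrow> real" where
  "mu_minor T = minor_semiaxis (excentral_inconic T)"

end

theory Submission
  imports Defs
begin

text \<open>Identify the plane with the complex numbers and let \<open>u\<close>, \<open>v\<close>, \<open>w\<close> be the unit vectors along
  the sides \<open>AB\<close>, \<open>BC\<close>, \<open>CA\<close> of a triangle. With a signed circumradius \<open>t\<close> and circumcenter \<open>m\<close>
  one has \<open>A = m - \<i> t w u / v\<close> and cyclically, the incenter is \<open>m + \<i> t (u + v + w)\<close>, and the
  excentral triangle is inscribed in a circle of radius \<open>2 \<bar>t\<bar>\<close> around \<open>m - \<i> t (u + v + w)\<close>.

  Let \<open>N = (A\<^sub>1 / a\<^sup>2, A\<^sub>2 / b\<^sup>2)\<close> at a bounce point \<open>A\<close>. For a 3-periodic the quantity \<open>J = u \<bullet> N\<close> (Joachimsthal) is the same at every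
  bounce. Put \<open>Q = J\<^sup>2 (a\<^sup>2 - b\<^sup>2)\<close> and \<open>P = J\<^sup>2 (a\<^sup>2 + b\<^sup>2) - 1\<close>. The reflection law at each vertex
  turns into \<open>P + Re (p cnj q) = Q Re (p q)\<close> for each pair \<open>p\<close>, \<open>q\<close> of side directions. Since
  the products \<open>u v\<close>, \<open>v w\<close>, \<open>w u\<close> are three distinct points of the unit circle, these
  linear conditions force \<open>u v + v w + w u = - Q\<close>, hence \<open>\<bar>u + v + w\<bar> = Q\<close>, and
  \<open>P = (1 - Q\<^sup>2) / 2\<close>. Hence \<open>Q\<close> solves \<open>(3 - Q\<^sup>2) (a\<^sup>2 - b\<^sup>2) = 2 Q (a\<^sup>2 + b\<^sup>2)\<close>, which determines it
  from \<open>a\<close> and \<open>b\<close>, and \<open>d = R Q\<close>, \<open>r = R (1 - Q\<^sup>2) / 2\<close>. The same relations say that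
  the axis-parallel ellipse around the Bevan point with semiaxes \<open>R (1 \<plusminus> Q)\<close> touches the sides of
  the excentral triangle, so only \<open>R\<close> varies; it does, as the two isosceles 3-periodics show.\<close>

subsection \<open>Points as complex numbers\<close>

definition pt :: "complex \<Rightarrow> point" where
  "pt z = vector [Re z, Im z]"

lemma pt_nth [simp]: "pt z $ 1 = Re z" "pt z $ 2 = Im z"
  by (simp_all add: pt_def)

lemma point_eq_iff: "X = Y \<longleftrightarrow> X $ 1 = Y $ 1 \<and> X $ 2 = (Y :: point) $ 2"
  by (simp add: vec_eq_iff forall_2)

lemma pt_eq_iff [simp]: "pt x = pt y \<longleftrightarrow> x = y"
  by (simp add: point_eq_iff complex_eq_iff)

lemma pt_cases: obtains z where "X = pt z"
  by (rule that [of "Complex (X $ 1) (X $ 2)"]) (simp add: point_eq_iff)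

lemma pt_add: "pt (x + y) = pt x + pt y"
  and pt_diff: "pt (x - y) = pt x - pt y"
  and pt_scaleR: "pt (c *\<^sub>R x) = c *\<^sub>R pt x"
  and pt_of_real_mult: "pt (of_real c * x) = c *\<^sub>R pt x"
  and pt_0: "pt 0 = 0"
  by (simp_all add: point_eq_iff)

lemma inner_point: "X \<bullet> Y = X $ 1 * Y $ 1 + X $ 2 * (Y :: point) $ 2"
  by (simp add: inner_vec_def sum_2)

lemma inner_pt: "pt x \<bullet> pt y = Re (x * cnj y)"
  by (simp add: inner_point)

lemma norm_pt [simp]: "norm (pt z) = cmod z"
  unfolding norm_eq_sqrt_inner by (simp add: inner_point inner_complex_def)

lemma dist_pt: "dist (pt x) (pt y) = cmod (x - y)"
  by (simp add: dist_norm flip: pt_diff)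

lemma sgn_pt: "sgn (pt z) = pt (sgn z)"
  by (simp add: sgn_div_norm pt_scaleR)

lemma Im_0_iff_cnj: "Im z = 0 \<longleftrightarrow> z = cnj z"
  by (simp add: complex_eq_iff)

lemma cnj_mult_unit: "cmod z = 1 \<Longrightarrow> z * cnj z = 1"
  by (simp add: complex_norm_square [symmetric])

text \<open>The condition says that \<open>(z - p) / v\<close> is real, and this quotient is the
  parameter of \<open>z\<close> on the line.\<close>

lemma mem_line_dir:
  assumes "v \<noteq> 0" and "Im ((z - p) * cnj v) = 0"
  shows "pt z \<in> line_dir (pt p) (pt v)"
proof -
  define k where "k = Re ((z - p) * cnj v) / (cmod v)\<^sup>2"
  have "(z - p) * cnj v = of_real (Re ((z - p) * cnj v))"
    using assms(2) by (simp add: complex_eq_iff)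
  then have "(z - p) * cnj v * v = of_real k * (cnj v * v) * v"
    using assms(1) complex_norm_square [of v] by (simp add: k_def mult.commute)
  then have "z - p = of_real k * v"
    using assms(1) by simp
  then have "z = p + k *\<^sub>R v"
    by (simp add: scaleR_conv_of_real algebra_simps)
  then have "pt z = pt p + k *\<^sub>R pt v"
    by (simp only: pt_add pt_scaleR)
  then show ?thesis
    by (auto simp: line_dir_def)
qed

text \<open>The difference of two common points is a real multiple of both \<open>v\<close> and
  \<open>w\<close>; multiplying by \<open>cnj w\<close> and taking imaginary parts makes it zero.
  This settles uniqueness of the incenter and of the excenters.\<close>

lemma line_dir_inter_unique:
  assumes "X \<in> line_dir P (pt v)" "X \<in> line_dir P' (pt w)"
    and "Y \<in> line_dir P (pt v)" "Y \<in> line_dir P' (pt w)"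
    and "Im (v * cnj w) \<noteq> 0"
  shows "X = Y"
proof -
  obtain s where s: "X - Y = s *\<^sub>R pt v"
    using assms(1,3) unfolding line_dir_def
    by (smt (verit) add_diff_cancel_left mem_Collect_eq scaleR_left_diff_distrib)
  obtain s' where s': "X - Y = s' *\<^sub>R pt w"
    using assms(2,4) unfolding line_dir_def
    by (smt (verit) add_diff_cancel_left mem_Collect_eq scaleR_left_diff_distrib)
  have "s *\<^sub>R v = s' *\<^sub>R w"
    using s s' by (simp flip: pt_scaleR)
  then have "s * Im (v * cnj w) = s' * Im (w * cnj w)"
    by (metis Im_complex_of_real mult_scaleR_left scaleR_complex.simps(2))
  then have "s = 0"
    using assms(5) by simp
  with s show ?thesis by simp
qed

lemma mem_line_dir_multiple:
  assumes "line_dir P v = line_dir P w"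
  obtains k where "w = k *\<^sub>R v"
proof -
  have "P + w \<in> line_dir P w"
    by (auto simp: line_dir_def intro: exI [of _ 1])
  then obtain k where "P + w = P + k *\<^sub>R v"
    unfolding assms [symmetric] by (auto simp: line_dir_def)
  then have "w = k *\<^sub>R v" by simp
  then show ?thesis by (rule that)
qed

lemma line_dir_scaleR: "k \<noteq> 0 \<Longrightarrow> line_dir P (k *\<^sub>R v) = line_dir P v"
proof (safe, goal_cases)
  case (2 X)
  then obtain s where "X = P + s *\<^sub>R v" by (auto simp: line_dir_def)
  then have "X = P + (s / k) *\<^sub>R (k *\<^sub>R v)" using 2 by simp
  then show ?case unfolding line_dir_def by blast
qed (auto simp: line_dir_def)

lemma circumcenter_eq:
  assumes "dist (pt p) (pt x) = dist (pt p) (pt y)" "dist (pt p) (pt y) = dist (pt p) (pt z)"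
    and "Im ((y - x) * cnj (z - y)) \<noteq> 0"
  shows "circumcenter (pt x, pt y, pt z) = pt p"
  unfolding circumcenter.simps
proof (rule the_equality)
  show "dist (pt p) (pt x) = dist (pt p) (pt y) \<and> dist (pt p) (pt y) = dist (pt p) (pt z)"
    using assms by simp
next
  fix X assume X: "dist X (pt x) = dist X (pt y) \<and> dist X (pt y) = dist X (pt z)"
  obtain q where q: "X = pt q" by (rule pt_cases)
  have bisect: "Re ((q - p) * cnj (y - x)) = 0"
    if "dist (pt q) (pt x) = dist (pt q) (pt y)" "dist (pt p) (pt x) = dist (pt p) (pt y)" for x y
  proof -
    have "(cmod (q - x))\<^sup>2 = (cmod (q - y))\<^sup>2" "(cmod (p - x))\<^sup>2 = (cmod (p - y))\<^sup>2"
      using that by (simp_all add: dist_pt)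
    then show ?thesis unfolding cmod_power2 by (simp add: power2_eq_square algebra_simps)
  qed
  have "Re ((q - p) * cnj (y - x)) = 0" "Re ((q - p) * cnj (z - y)) = 0"
    using assms(1,2) X unfolding q by (blast intro: bisect)+
  then have *: "Re (q - p) * Re (y - x) + Im (q - p) * Im (y - x) = 0"
    "Re (q - p) * Re (z - y) + Im (q - p) * Im (z - y) = 0"
    by (simp_all add: algebra_simps)
  \<comment> \<open>Cramer's rule: \<open>q - p\<close> is orthogonal to two sides that are not
    parallel.\<close>
  have "Im ((y - x) * cnj (z - y)) * Re (q - p) = 0 \<and> Im ((y - x) * cnj (z - y)) * Im (q - p) = 0"
    using * unfolding times_complex.sel cnj.sel by algebra
  then show "X = pt p"
    using assms(3) by (simp add: q complex_eq_iff)
qed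

subsection \<open>Triangles in terms of their side directions\<close>

text \<open>The three inequalities say that the sides, of lengths \<open>2 t Im (v cnj w)\<close> etc., point along \<open>u\<close>, \<open>v\<close>, \<open>w\<close>;
  \<open>t\<close> is negative for counterclockwise triangles.\<close>

definition frame :: "complex \<Rightarrow> complex \<Rightarrow> complex \<Rightarrow> real \<Rightarrow> bool" where
  "frame u v w t \<longleftrightarrow> cmod u = 1 \<and> cmod v = 1 \<and> cmod w = 1 \<and>
     0 < t * Im (v * cnj w) \<and> 0 < t * Im (w * cnj u) \<and> 0 < t * Im (u * cnj v)"

text \<open>The vertex between the incoming side \<open>p\<close> and the outgoing side \<open>q\<close>, opposite to \<open>s\<close>.\<close>

definition corner :: "complex \<Rightarrow> real \<Rightarrow> complex \<Rightarrow> complex \<Rightarrow> complex \<Rightarrow> complex" where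
  "corner m t p q s = m - \<i> * of_real t * p * q * cnj s"

definition framed_triangle ::
    "complex \<Rightarrow> real \<Rightarrow> complex \<Rightarrow> complex \<Rightarrow> complex \<Rightarrow> triangle" where
  "framed_triangle m t u v w =
     (pt (corner m t w u v), pt (corner m t u v w), pt (corner m t v w u))"

lemma frame_cycle: "frame u v w t \<Longrightarrow> frame v w u t"
  by (simp add: frame_def)

lemma frame_distinct:
  assumes "frame u v w t"
  shows "u \<noteq> v" "v \<noteq> w" "w \<noteq> u" "u + v \<noteq> 0" "v + w \<noteq> 0" "w + u \<noteq> 0" "t \<noteq> 0"
  using assms by (auto simp: frame_def add_eq_0_iff)

lemma frame_mult_cnj:
  assumes "frame u v w t"
  shows "u * cnj u = 1" "v * cnj v = 1" "w * cnj w = 1"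
  using assms by (auto simp: frame_def cnj_mult_unit)

text \<open>Both corners carry the factor \<open>u\<close>, and what remains,
  \<open>\<i> t (w cnj v - v cnj w)\<close>, is real. So the side runs along \<open>u\<close>, with
  signed length \<open>2 t Im (v cnj w)\<close>.\<close>

lemma corner_diff:
  assumes "cmod u = 1"
  shows "corner m t u v w - corner m t w u v = of_real (2 * t * Im (v * cnj w)) * u"
proof -
  have "of_real (2 * Im (v * cnj w)) * \<i> = v * cnj w - cnj v * w"
    by (simp add: complex_eq_iff)
  then have "of_real (2 * t * Im (v * cnj w)) * \<i> = t * (v * cnj w - cnj v * w)"
    by (metis (no_types, opaque_lifting) mult.assoc mult.left_commute of_real_mult)
  then have "\<i> * (of_real (2 * t * Im (v * cnj w)) * \<i>) * u = \<i> * (t * (v * cnj w - cnj v * w)) * u"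
    by simp
  then show ?thesis by (simp add: corner_def algebra_simps del: of_real_mult)
qed

lemma frame_sgn:
  assumes "frame u v w t"
  shows "sgn (corner m t u v w - corner m t w u v) = u"
    and "sgn (corner m t w u v - corner m t u v w) = - u"
proof -
  have "sgn (of_real (2 * t * Im (v * cnj w)) * u) = of_real (sgn (2 * t * Im (v * cnj w))) * sgn u"
    unfolding sgn_mult sgn_of_real ..
  also have "\<dots> = u"
    using assms unfolding frame_def by (simp add: mult.assoc sgn_eq del: times_complex.sel)
  finally show *: "sgn (corner m t u v w - corner m t w u v) = u"
    using assms by (subst corner_diff) (auto simp: frame_def)
  show "sgn (corner m t w u v - corner m t u v w) = - u"
    using * by (metis minus_diff_eq sgn_minus)
qed

text \<open>Seen from this corner, the unit vectors towards the other two are \<open>u\<close> and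
  \<open>- w\<close>, because \<open>w\<close> points into the corner.\<close>

lemma bisectors_framed:
  assumes "frame u v w t"
  shows "internal_bisector (pt (corner m t w u v)) (pt (corner m t u v w)) (pt (corner m t v w u))
       = line_dir (pt (corner m t w u v)) (pt (u - w))"
    and "external_bisector (pt (corner m t w u v)) (pt (corner m t u v w)) (pt (corner m t v w u))
       = line_dir (pt (corner m t w u v)) (pt (u + w))"
  using frame_sgn(1) [OF assms, of m] frame_sgn(2) [OF frame_cycle [OF frame_cycle [OF assms]], of m]
  unfolding internal_bisector_def external_bisector_def
  by (simp_all flip: pt_diff add: sgn_pt) (simp_all flip: pt_diff pt_add)

text \<open>For unit \<open>p\<close>, \<open>q\<close> one has
  \<open>cnj p - cnj q = (q - p) cnj p cnj q\<close>, and similarly for sums. Parallel bisectors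
  would therefore make a product of sums or differences of side directions vanish, none of which is
  zero in a frame.\<close>

lemma frame_not_parallel:
  assumes "frame u v w t"
  shows "Im ((u - w) * cnj (v - u)) \<noteq> 0" and "Im ((v + u) * cnj (w + v)) \<noteq> 0"
proof -
  note d = frame_distinct [OF assms]
  have sub: "cnj p - cnj q = (q - p) * cnj p * cnj q" and add: "cnj p + cnj q = (p + q) * cnj p * cnj q"
    if "p * cnj p = 1" "q * cnj q = 1" for p q
    using that by algebra+
  have nz: "u \<noteq> 0" "v \<noteq> 0" "w \<noteq> 0"
    using assms by (auto simp: frame_def)
  show "Im ((u - w) * cnj (v - u)) \<noteq> 0"
  proof
    assume "Im ((u - w) * cnj (v - u)) = 0"
    then have "(u - w) * (cnj v - cnj u) = (cnj u - cnj w) * (v - u)"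
      unfolding Im_0_iff_cnj by simp
    then have "(u - w) * ((u - v) * cnj v * cnj u) = (w - u) * cnj u * cnj w * (v - u)"
      using sub frame_mult_cnj [OF assms] by simp
    then have "(u - w) * (u - v) * cnj u * (cnj v - cnj w) = 0"
      by algebra
    then show False using d nz by auto
  qed
  show "Im ((v + u) * cnj (w + v)) \<noteq> 0"
  proof
    assume "Im ((v + u) * cnj (w + v)) = 0"
    then have "(v + u) * (cnj w + cnj v) = (cnj v + cnj u) * (w + v)"
      unfolding Im_0_iff_cnj by simp
    then have "(v + u) * ((w + v) * cnj w * cnj v) = (v + u) * cnj v * cnj u * (w + v)"
      using add frame_mult_cnj [OF assms] by simp
    then have "(v + u) * (w + v) * cnj v * (cnj w - cnj u) = 0"
      by algebra
    then show False using d nz by (auto simp: add.commute)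
  qed
qed

text \<open>The point is symmetric in \<open>u\<close>, \<open>v\<close>, \<open>w\<close>, so one
  bisector gives all three by cycling. The claim says that a product equals its conjugate, which is
  a polynomial identity modulo \<open>p cnj p = 1\<close>.\<close>

lemma frame_incenter_mem:
  assumes "frame u v w t"
  shows "Im ((m + \<i> * of_real t * (u + v + w) - corner m t w u v) * cnj (u - w)) = 0"
proof -
  have "(u + v + w + w * u * cnj v) * (cnj u - cnj w) + (cnj u + cnj v + cnj w + cnj w * cnj u * v) * (u - w) = 0"
    using frame_mult_cnj [OF assms] by algebra
  then show ?thesis
    unfolding Im_0_iff_cnj corner_def by simp algebra
qed

text \<open>These are the incenter identities with \<open>u\<close>, \<open>w\<close> replaced by
  \<open>- u\<close>, \<open>- w\<close>. The sign change fixes all three corners and the internal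
  bisector at the first one, and it turns the internal bisectors at the other two into external
  ones.\<close>

lemma frame_excenter_mem:
  assumes "frame u v w t"
  shows "Im ((m - \<i> * of_real t * (u + w - v) - corner m t w u v) * cnj (u - w)) = 0"
    and "Im ((m - \<i> * of_real t * (u + w - v) - corner m t u v w) * cnj (v + u)) = 0"
    and "Im ((m - \<i> * of_real t * (u + w - v) - corner m t v w u) * cnj (w + v)) = 0"
proof -
  have "(u + w - v - w * u * cnj v) * (cnj u - cnj w) + (cnj u + cnj w - cnj v - cnj w * cnj u * v) * (u - w) = 0"
    using frame_mult_cnj [OF assms] by algebra
  then show "Im ((m - \<i> * of_real t * (u + w - v) - corner m t w u v) * cnj (u - w)) = 0"
    unfolding Im_0_iff_cnj corner_def by simp algebra
  have "(u + w - v - u * v * cnj w) * (cnj v + cnj u) + (cnj u + cnj w - cnj v - cnj u * cnj v * w) * (v + u) = 0"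
    using frame_mult_cnj [OF assms] by algebra
  then show "Im ((m - \<i> * of_real t * (u + w - v) - corner m t u v w) * cnj (v + u)) = 0"
    unfolding Im_0_iff_cnj corner_def by simp algebra
  have "(u + w - v - v * w * cnj u) * (cnj w + cnj v) + (cnj u + cnj w - cnj v - cnj v * cnj w * u) * (w + v) = 0"
    using frame_mult_cnj [OF assms] by algebra
  then show "Im ((m - \<i> * of_real t * (u + w - v) - corner m t v w u) * cnj (w + v)) = 0"
    unfolding Im_0_iff_cnj corner_def by simp algebra
qed

section \<open>Circumcenter, incenter and excenters of a framed triangle\<close>

lemma dist_corner:
  assumes "frame u v w t"
  shows "dist (pt m) (pt (corner m t u v w)) = \<bar>t\<bar>"
  using assms by (simp add: dist_pt corner_def frame_def norm_mult)

lemma circumcenter_framed: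
  assumes "frame u v w t"
  shows "circumcenter (framed_triangle m t u v w) = pt m"
    and "circumradius (framed_triangle m t u v w) = \<bar>t\<bar>"
proof -
  note f1 = assms and f2 = frame_cycle [OF assms]
  note f3 = frame_cycle [OF f2]
  have u: "cmod u = 1" "cmod v = 1"
    using assms by (auto simp: frame_def)
  have "Im (u * cnj v) \<noteq> 0" "t * Im (v * cnj w) \<noteq> 0" "t * Im (w * cnj u) \<noteq> 0"
    using assms unfolding frame_def by fastforce+
  moreover have "Im ((of_real p * x) * cnj (of_real q * y)) = p * q * Im (x * cnj y)" for p q x y
    by (simp add: algebra_simps)
  ultimately have "Im ((corner m t u v w - corner m t w u v) * cnj (corner m t v w u - corner m t u v w)) \<noteq> 0"
    unfolding corner_diff [OF u(1)] corner_diff [OF u(2)] by simp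
  then show *: "circumcenter (framed_triangle m t u v w) = pt m"
    unfolding framed_triangle_def
    by (intro circumcenter_eq) (simp_all add: dist_corner [OF f1] dist_corner [OF f2] dist_corner [OF f3])
  then show "circumradius (framed_triangle m t u v w) = \<bar>t\<bar>"
    unfolding framed_triangle_def by (simp add: dist_corner [OF f3] del: circumcenter.simps)
qed

lemma incenter_framed:
  assumes "frame u v w t"
  shows "incenter (framed_triangle m t u v w) = pt (m + \<i> * of_real t * (u + v + w))"
proof -
  note f1 = assms and f2 = frame_cycle [OF assms]
  note f3 = frame_cycle [OF f2]
  note d = frame_distinct [OF assms]
  have *: "pt (m + \<i> * of_real t * (u + v + w)) \<in> line_dir (pt (corner m t w u v)) (pt (u - w))"
    "pt (m + \<i> * of_real t * (u + v + w)) \<in> line_dir (pt (corner m t u v w)) (pt (v - u))"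
    "pt (m + \<i> * of_real t * (u + v + w)) \<in> line_dir (pt (corner m t v w u)) (pt (w - v))"
    using d frame_incenter_mem [OF f1, of m] frame_incenter_mem [OF f2, of m] frame_incenter_mem [OF f3, of m]
    by (auto intro!: mem_line_dir simp only: add.commute add.left_commute right_minus_eq)
  show ?thesis
    unfolding framed_triangle_def incenter.simps bisectors_framed(1) [OF f1]
      bisectors_framed(1) [OF f2] bisectors_framed(1) [OF f3]
    using * frame_not_parallel(1) [OF f1] by (blast intro: the_equality line_dir_inter_unique)
qed

lemma excenter_framed:
  assumes "frame u v w t"
  shows "excenter (pt (corner m t w u v)) (pt (corner m t u v w)) (pt (corner m t v w u))
       = pt (m - \<i> * of_real t * (u + w - v))"
proof -
  note f1 = assms and f2 = frame_cycle [OF assms]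
  note f3 = frame_cycle [OF f2]
  note d = frame_distinct [OF assms]
  have *: "pt (m - \<i> * of_real t * (u + w - v)) \<in> line_dir (pt (corner m t w u v)) (pt (u - w))"
    "pt (m - \<i> * of_real t * (u + w - v)) \<in> line_dir (pt (corner m t u v w)) (pt (v + u))"
    "pt (m - \<i> * of_real t * (u + w - v)) \<in> line_dir (pt (corner m t v w u)) (pt (w + v))"
    using mem_line_dir [OF _ frame_excenter_mem(1) [OF f1]] mem_line_dir [OF _ frame_excenter_mem(2) [OF f1]]
      mem_line_dir [OF _ frame_excenter_mem(3) [OF f1]] d by (simp_all add: add.commute)
  show ?thesis
    unfolding excenter_def bisectors_framed(1) [OF f1] bisectors_framed(2) [OF f2] bisectors_framed(2) [OF f3]
    using * frame_not_parallel(2) [OF f1] by (blast intro: the_equality line_dir_inter_unique)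
qed

text \<open>The reflection of the incenter \<open>m + \<i> t (u + v + w)\<close> in the circumcenter
  \<open>m\<close>.\<close>

definition bevan :: "complex \<Rightarrow> real \<Rightarrow> complex \<Rightarrow> complex \<Rightarrow> complex \<Rightarrow> complex" where
  "bevan m t u v w = m - \<i> * of_real t * (u + v + w)"

text \<open>The excenters are written relative to the Bevan point because the three offsets then
  have the same modulus \<open>2 \<bar>t\<bar>\<close>, which exhibits the circumcenter.\<close>

lemma excentral_framed:
  assumes "frame u v w t"
  shows "excentral (framed_triangle m t u v w) =
    (pt (bevan m t u v w + 2 * \<i> * of_real t * v),
     pt (bevan m t u v w + 2 * \<i> * of_real t * w),
     pt (bevan m t u v w + 2 * \<i> * of_real t * u))"
proof -
  note f1 = assms and f2 = frame_cycle [OF assms]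
  note f3 = frame_cycle [OF f2]
  show ?thesis
    unfolding framed_triangle_def excentral.simps excenter_framed [OF f1]
      excenter_framed [OF f2] excenter_framed [OF f3] bevan_def
    by (simp add: algebra_simps)
qed

lemma circumcenter_excentral_framed:
  assumes "frame u v w t"
  shows "circumcenter (excentral (framed_triangle m t u v w)) = pt (bevan m t u v w)"
proof -
  have "Im ((w - v) * cnj (u - w)) \<noteq> 0"
    using frame_not_parallel(1) [OF frame_cycle [OF frame_cycle [OF assms]]] .
  moreover have scale: "Im ((2 * \<i> * of_real t * p) * cnj (2 * \<i> * of_real t * q)) = 4 * t\<^sup>2 * Im (p * cnj q)" for p q
    by (simp add: power2_eq_square algebra_simps)
  ultimately have "Im ((2 * \<i> * of_real t * (w - v)) * cnj (2 * \<i> * of_real t * (u - w))) \<noteq> 0"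
    using frame_distinct(7) [OF assms] unfolding scale by simp
  then show ?thesis
    unfolding excentral_framed [OF assms] using assms
    by (intro circumcenter_eq)
      (simp_all add: dist_pt frame_def norm_mult right_diff_distrib del: complex_cnj_mult times_complex.sel)
qed

section \<open>Sidelines, the inradius and the existence of frames\<close>

lemma sideline_line_dir: "sideline (pt x) (pt y) = line_dir (pt x) (pt (y - x))"
proof -
  have "sideline (pt x) (pt y) = {pt x + s *\<^sub>R (pt y - pt x) | s. True}"
    unfolding sideline_def affine_hull_2_alt by auto
  then show ?thesis by (simp add: line_dir_def pt_diff)
qed

lemma sideline_eq:
  assumes "n \<bullet> X = h" "n \<bullet> Y = h" "X \<noteq> Y" "n \<noteq> 0"
  shows "sideline X Y = {Z. n \<bullet> Z = h}"
proof -
  obtain x y \<nu> where [simp]: "X = pt x" "Y = pt y" "n = pt \<nu>"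
    by (metis pt_cases)
  have "\<nu> \<noteq> 0" using assms pt_0 by auto
  have "Z \<in> line_dir (pt x) (pt (y - x))" if Z: "pt \<nu> \<bullet> Z = h" for Z
  proof -
    obtain z where [simp]: "Z = pt z" by (rule pt_cases)
    have *: "Re \<nu> * Re (z - x) + Im \<nu> * Im (z - x) = 0" "Re \<nu> * Re (y - x) + Im \<nu> * Im (y - x) = 0"
      using assms(1,2) Z by (simp_all add: inner_pt algebra_simps)
    then have "Re \<nu> * (Im (z - x) * Re (y - x) - Re (z - x) * Im (y - x)) = 0"
      "Im \<nu> * (Im (z - x) * Re (y - x) - Re (z - x) * Im (y - x)) = 0"
      by algebra+
    then have "Im (z - x) * Re (y - x) - Re (z - x) * Im (y - x) = 0"
      using \<open>\<nu> \<noteq> 0\<close> complex_eq_iff by auto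
    then have "Im ((z - x) * cnj (y - x)) = 0"
      by (simp add: algebra_simps)
    then show ?thesis
      using assms(3) by (auto intro: mem_line_dir)
  qed
  moreover have "n \<bullet> Z = h" if "Z \<in> line_dir (pt x) (pt (y - x))" for Z
    using that assms(1,2) by (auto simp: line_dir_def inner_simps pt_diff)
  ultimately show ?thesis
    by (auto simp: sideline_line_dir)
qed

lemma infdist_hyperplane:
  fixes n :: "'a::euclidean_space"
  assumes "norm n = 1"
  shows "infdist P {Z. n \<bullet> Z = h} = \<bar>n \<bullet> P - h\<bar>"
proof -
  \<comment> \<open>The foot of the perpendicular from \<open>P\<close>; that no point is closer is
    the Cauchy-Schwarz inequality.\<close>
  define F where "F = P - (n \<bullet> P - h) *\<^sub>R n"
  have F: "F \<in> {Z. n \<bullet> Z = h}"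
    using assms by (simp add: F_def inner_simps norm_eq_1)
  have "dist P F = \<bar>n \<bullet> P - h\<bar>"
    using assms by (simp add: F_def dist_norm)
  then have "infdist P {Z. n \<bullet> Z = h} \<le> \<bar>n \<bullet> P - h\<bar>"
    using infdist_le [OF F, of P] by simp
  moreover have "\<bar>n \<bullet> P - h\<bar> \<le> dist P Z" if "n \<bullet> Z = h" for Z
    using Cauchy_Schwarz_ineq2 [of n "P - Z"] that assms by (simp add: inner_simps dist_norm)
  then have "\<bar>n \<bullet> P - h\<bar> \<le> infdist P {Z. n \<bullet> Z = h}"
    using F unfolding infdist_def by (auto intro!: cINF_greatest)
  ultimately show ?thesis by simp
qed

text \<open>Measured along the unit normal \<open>\<i> u\<close> of the first side, the incenter has
  signed distance \<open>t (1 + S)\<close>, where \<open>S\<close> is the sum of the inner products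
  of the pairs of side directions; and \<open>\<bar>u + v + w\<bar>\<close> has square
  \<open>3 + 2 S\<close>.\<close>

lemma inradius_framed:
  assumes "frame u v w t"
  shows "inradius (framed_triangle m t u v w) = \<bar>t * ((cmod (u + v + w))\<^sup>2 - 1) / 2\<bar>"
proof -
  define n where "n = pt (\<i> * u)"
  let ?A = "corner m t w u v" and ?B = "corner m t u v w"
  have unit: "cmod u = 1" "cmod v = 1" "cmod w = 1" and "t * Im (v * cnj w) > 0"
    using assms by (auto simp: frame_def)
  have "n \<bullet> (pt ?B - pt ?A) = 0"
    unfolding n_def pt_diff [symmetric] inner_pt corner_diff [OF unit(1)]
    by (simp add: algebra_simps)
  moreover have "?A \<noteq> ?B"
  proof
    assume "?A = ?B"
    then have "of_real (2 * t * Im (v * cnj w)) * u = 0"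
      using corner_diff [OF unit(1), of m t v w] by simp
    then have "2 * t * Im (v * cnj w) = 0"
      using unit(1) by (metis mult_eq_0_iff norm_zero of_real_eq_0_iff zero_neq_one of_real_mult)
    then show False
      using \<open>t * Im (v * cnj w) > 0\<close> by auto
  qed
  moreover have "n \<noteq> 0"
    using unit(1) pt_0 by (metis n_def norm_mult norm_ii norm_pt norm_zero mult_1 zero_neq_one)
  ultimately have s: "sideline (pt ?A) (pt ?B) = {Z. n \<bullet> Z = n \<bullet> pt ?A}"
    by (intro sideline_eq) (auto simp: inner_simps)
  have "u * cnj u = 1" "w * cnj w = 1" "v * cnj v = 1"
    using unit by (simp_all add: cnj_mult_unit)
  then have "(u + v + w + w * u * cnj v) * cnj u = 1 + v * cnj u + w * cnj u + w * cnj v"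
    by algebra
  moreover have "\<i> * of_real t * z * cnj (\<i> * u) = of_real t * (z * cnj u)" for z
    by (simp add: complex_eq_iff algebra_simps)
  ultimately have "\<i> * of_real t * (u + v + w + w * u * cnj v) * cnj (\<i> * u) = of_real t * (1 + v * cnj u + w * cnj u + w * cnj v)"
    by simp
  moreover have "m + \<i> * of_real t * (u + v + w) - ?A = \<i> * of_real t * (u + v + w + w * u * cnj v)"
    by (simp add: corner_def algebra_simps)
  ultimately have "n \<bullet> (pt (m + \<i> * of_real t * (u + v + w)) - pt ?A) = Re (of_real t * (1 + v * cnj u + w * cnj u + w * cnj v))"
    unfolding n_def pt_diff [symmetric] by (subst inner_commute, unfold inner_pt, presburger)
  also have "(cmod (u + v + w))\<^sup>2 - 1 = 2 * Re (1 + v * cnj u + w * cnj u + w * cnj v)"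
    using unit [THEN arg_cong, of "\<lambda>x. x\<^sup>2"] unfolding cmod_power2
    by (simp add: power2_eq_square algebra_simps)
  then have "Re (of_real t * (1 + v * cnj u + w * cnj u + w * cnj v)) = t * ((cmod (u + v + w))\<^sup>2 - 1) / 2"
    by simp
  finally show ?thesis
    using s incenter_framed [OF assms, of m] unit(1)
    unfolding framed_triangle_def inradius.simps
    by (simp add: infdist_hyperplane n_def norm_mult del: incenter.simps flip: inner_diff_right)
qed

text \<open>The law of sines makes \<open>t\<close> independent of the side used to define it.\<close>

lemma framed_triangle_exists:
  assumes "\<not> collinear {A, B, C}"
  obtains m t u v w where "frame u v w t" "(A, B, C) = framed_triangle m t u v w"
proof -
  obtain x y z where [simp]: "A = pt x" "B = pt y" "C = pt z"
    by (metis pt_cases)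
  have "x \<noteq> y" "y \<noteq> z" "z \<noteq> x"
    using assms by (auto simp: insert_commute)
  define u v w where uvw: "u = sgn (y - x)" "v = sgn (z - y)" "w = sgn (x - z)"
  define a b c where abc: "a = cmod (z - y)" "b = cmod (x - z)" "c = cmod (y - x)"
  have pos: "a > 0" "b > 0" "c > 0"
    using \<open>x \<noteq> y\<close> \<open>y \<noteq> z\<close> \<open>z \<noteq> x\<close> by (auto simp: abc)
  have unit: "cmod u = 1" "cmod v = 1" "cmod w = 1"
    using \<open>x \<noteq> y\<close> \<open>y \<noteq> z\<close> \<open>z \<noteq> x\<close> by (auto simp: uvw norm_sgn)
  have edge: "y - x = of_real c * u" "z - y = of_real a * v" "x - z = of_real b * w"
    using pos by (auto simp: uvw abc sgn_eq)
  have sum: "of_real c * u + of_real a * v + of_real b * w = 0"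
    unfolding edge [symmetric] by simp
  have "Im (of_real c * u + of_real a * v + of_real b * w) = 0" "Re (of_real c * u + of_real a * v + of_real b * w) = 0"
    by (simp_all only: sum zero_complex.sel)
  then have lin: "c * Im u + a * Im v + b * Im w = 0" "c * Re u + a * Re v + b * Re w = 0"
    by simp_all
  define X where "X = Im (v * cnj w)"
  have X: "X \<noteq> 0"
  proof
    assume "X = 0"
    have "x - y = of_real b * w + of_real a * v"
      unfolding edge [symmetric] by simp
    then have "Im ((x - y) * cnj (z - y)) = - a * b * X"
      unfolding edge(2) by (simp add: X_def algebra_simps)
    with \<open>X = 0\<close> \<open>y \<noteq> z\<close> have "pt x \<in> affine hull {pt y, pt z}"
      unfolding sideline_def [symmetric] sideline_line_dir by (intro mem_line_dir) auto
    then have "collinear {pt y, pt z, pt x}"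
      using \<open>y \<noteq> z\<close> by (simp add: collinear_3_affine_hull)
    then show False using assms by (simp add: insert_commute)
  qed
  have Y: "c * Im (w * cnj u) = a * X" and Z: "c * Im (u * cnj v) = b * X"
    unfolding X_def using lin by (simp, algebra)+
  define t where "t = c / (2 * X)"
  have t: "2 * t * X = c" "2 * t * Im (w * cnj u) = a" "2 * t * Im (u * cnj v) = b"
    using X Y Z by (simp_all add: t_def field_simps)
  have f: "frame u v w t"
    using pos t unit unfolding frame_def X_def [symmetric] by linarith
  \<comment> \<open>Solves \<open>corner m t w u v = x\<close>; the other two corners follow by
    adding the sides.\<close>
  define m where "m = x + \<i> * of_real t * w * u * cnj v"
  have "corner m t w u v = x"
    by (simp add: corner_def m_def)
  moreover from this have "corner m t u v w = y"
    using corner_diff [OF unit(1), of m t v w] edge(1) unfolding X_def [symmetric] t(1) by (simp add: diff_eq_eq)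
  moreover from this have "corner m t v w u = z"
    using corner_diff [OF unit(2), of m t w u] edge(2) unfolding t(2) by (simp add: diff_eq_eq)
  ultimately show ?thesis
    using that [OF f, of m] by (simp add: framed_triangle_def)
qed

subsection \<open>Inconics with a given center\<close>

text \<open>Symmetry and the center equations express the off-diagonal entries of the last row and
  column through \<open>c\<close> and the upper left block. Recentering at \<open>c\<close> then
  removes the linear terms.\<close>

lemma hom_coords_form:
  assumes "transpose M = M" and "conic_center M c"
  shows "hom_coords X \<bullet> (M *v hom_coords Y) =
      M$1$1 * (X$1 - c$1) * (Y$1 - c$1)
      + M$1$2 * ((X$1 - c$1) * (Y$2 - c$2) + (X$2 - c$2) * (Y$1 - c$1))
      + M$2$2 * (X$2 - c$2) * (Y$2 - c$2) + (M *v hom_coords c)$3"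
    and "det M = (M *v hom_coords c)$3 * (M$1$1 * M$2$2 - (M$1$2)\<^sup>2)"
proof -
  have "transpose M $ i $ j = M $ j $ i" for i j
    by (simp add: transpose_def)
  then have sym: "M$2$1 = M$1$2" "M$3$1 = M$1$3" "M$3$2 = M$2$3"
    using assms(1) by simp_all
  have center: "M$1$3 = - (M$1$1 * c$1 + M$1$2 * c$2)" "M$2$3 = - (M$1$2 * c$1 + M$2$2 * c$2)"
    using assms(2) by (simp_all add: conic_center_def matrix_vector_mult_def sum_3 hom_coords_def sym)
  show "hom_coords X \<bullet> (M *v hom_coords Y) =
      M$1$1 * (X$1 - c$1) * (Y$1 - c$1)
      + M$1$2 * ((X$1 - c$1) * (Y$2 - c$2) + (X$2 - c$2) * (Y$1 - c$1))
      + M$2$2 * (X$2 - c$2) * (Y$2 - c$2) + (M *v hom_coords c)$3"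
    by (simp add: inner_vec_def matrix_vector_mult_def sum_3 hom_coords_def sym center algebra_simps)
  show "det M = (M *v hom_coords c)$3 * (M$1$1 * M$2$2 - (M$1$2)\<^sup>2)"
    by (simp add: det_3 matrix_vector_mult_def sum_3 hom_coords_def sym center algebra_simps power2_eq_square)
qed

text \<open>The left-hand side is a quadratic form in \<open>n\<close> plus a multiple of \<open>h\<^sup>2\<close>: the dual conic.\<close>

lemma tangent_dual_form:
  fixes n c :: point
  assumes M: "transpose M = M" "conic_center M c"
    and tangent: "tangent_to_conic {X. n \<bullet> (X - c) = h} M" and "h \<noteq> 0" "n \<noteq> 0"
  shows "(M *v hom_coords c)$3 * (M$2$2 * (n$1)\<^sup>2 - 2 * M$1$2 * n$1 * n$2 + M$1$1 * (n$2)\<^sup>2)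
      + (M$1$1 * M$2$2 - (M$1$2)\<^sup>2) * h\<^sup>2 = 0"
proof -
  obtain P where P: "P \<in> conic M" "{X. n \<bullet> (X - c) = h} = polar_line M P"
    using tangent by (auto simp: tangent_to_conic_def)
  define \<delta> where "\<delta> = (M *v hom_coords c)$3"
  define p q where "p = P$1 - c$1" and "q = P$2 - c$2"
  define r s where "r = M$1$1 * p + M$1$2 * q" and "s = M$1$2 * p + M$2$2 * q"
  define N where "N = (n$1)\<^sup>2 + (n$2)\<^sup>2"
  have "N \<noteq> 0"
    using \<open>n \<noteq> 0\<close> by (simp add: N_def vec_eq_iff forall_2 sum_power2_eq_zero_iff)
  have form: "hom_coords X \<bullet> (M *v hom_coords P) = r * (X$1 - c$1) + s * (X$2 - c$2) + \<delta>" for X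
    unfolding hom_coords_form(1) [OF M] r_def s_def p_def q_def \<delta>_def by (simp add: algebra_simps)
  have on_line: "r * x + s * y + \<delta> = 0 \<longleftrightarrow> n$1 * x + n$2 * y = h" for x y
  proof -
    define X :: point where "X = vector [c$1 + x, c$2 + y]"
    have "X \<in> polar_line M P \<longleftrightarrow> n \<bullet> (X - c) = h"
      using P(2) by auto
    then show ?thesis
      unfolding polar_line_def by (simp add: form inner_point) (simp add: X_def)
  qed
  \<comment> \<open>Two points of the line, relative to \<open>c\<close>: the foot of the
    perpendicular from \<open>c\<close> and its translate by \<open>(- n$2, n$1)\<close>. Evaluating
    the polar equation there shows that \<open>(r, s)\<close> is parallel to \<open>n\<close> and
    fixes its length.\<close>
  have "n$1 * (h * n$1 / N) + n$2 * (h * n$2 / N) = h * (N / N)"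
    unfolding N_def add_divide_distrib by (simp add: power2_eq_square algebra_simps)
  then have "n$1 * (h * n$1 / N) + n$2 * (h * n$2 / N) = h"
    "n$1 * (h * n$1 / N - n$2) + n$2 * (h * n$2 / N + n$1) = h"
    using \<open>N \<noteq> 0\<close> by (simp_all add: algebra_simps)
  then have "r * (h * n$1 / N) + s * (h * n$2 / N) + \<delta> = 0"
    "r * (h * n$1 / N - n$2) + s * (h * n$2 / N + n$1) + \<delta> = 0"
    unfolding on_line by auto
  then have "(h * (r * n$1 + s * n$2) + \<delta> * N) / N = 0" and "r * n$2 = s * n$1"
    using \<open>N \<noteq> 0\<close> by (simp_all add: add_divide_distrib algebra_simps)
  then have rs: "h * (r * n$1 + s * n$2) + \<delta> * N = 0" "r * n$2 = s * n$1"
    using \<open>N \<noteq> 0\<close> by simp_all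
  have "N * (h * r + \<delta> * n$1) = n$1 * (h * (r * n$1 + s * n$2) + \<delta> * N) + h * n$2 * (r * n$2 - s * n$1)"
    "N * (h * s + \<delta> * n$2) = n$2 * (h * (r * n$1 + s * n$2) + \<delta> * N) - h * n$1 * (r * n$2 - s * n$1)"
    by (simp_all add: N_def power2_eq_square algebra_simps)
  then have "N * (h * r + \<delta> * n$1) = 0" "N * (h * s + \<delta> * n$2) = 0"
    unfolding rs by simp_all
  then have rs: "h * r = - \<delta> * n$1" "h * s = - \<delta> * n$2"
    using \<open>N \<noteq> 0\<close> by (simp_all add: eq_neg_iff_add_eq_0)
  have "r * p + s * q + \<delta> = 0"
    using P(1) unfolding conic_def by (simp add: form p_def q_def)
  then have h: "n$1 * p + n$2 * q = h"
    using on_line by blast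
  define \<Delta> where "\<Delta> = M$1$1 * M$2$2 - (M$1$2)\<^sup>2"
  have "\<Delta> * h\<^sup>2 = \<Delta> * h * (n$1 * p + n$2 * q)"
    unfolding h by (simp add: power2_eq_square)
  \<comment> \<open>Cramer's rule expresses \<open>\<Delta> p\<close> and \<open>\<Delta> q\<close>
    by \<open>r\<close> and \<open>s\<close>.\<close>
  also have "\<dots> = n$1 * (M$2$2 * (h * r) - M$1$2 * (h * s)) + n$2 * (M$1$1 * (h * s) - M$1$2 * (h * r))"
    unfolding r_def s_def \<Delta>_def by (simp add: power2_eq_square algebra_simps)
  finally show ?thesis
    unfolding \<delta>_def [symmetric] \<Delta>_def [symmetric] rs by (simp add: power2_eq_square algebra_simps)
qed

text \<open>A nonzero binary quadratic form vanishes on at most two lines through the origin. The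
  product of the three cross products is, up to sign, the determinant of the linear system for
  \<open>A\<close>, \<open>B\<close>, \<open>C\<close>.\<close>

lemma binary_quadratic_form_zero:
  fixes A B C n n' m m' k k' :: real
  assumes "A * n\<^sup>2 + B * n * n' + C * n'\<^sup>2 = 0"
    and "A * m\<^sup>2 + B * m * m' + C * m'\<^sup>2 = 0"
    and "A * k\<^sup>2 + B * k * k' + C * k'\<^sup>2 = 0"
    and "n * m' - n' * m \<noteq> 0" "m * k' - m' * k \<noteq> 0" "k * n' - k' * n \<noteq> 0"
  shows "A = 0" "B = 0" "C = 0"
proof -
  have "(n * m' - n' * m) * (m * k' - m' * k) * (k * n' - k' * n) * A = 0"
    using assms(1-3) by algebra
  then show "A = 0" using assms by simp
  have "(n * m' - n' * m) * (m * k' - m' * k) * (k * n' - k' * n) * B = 0"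
    using assms(1-3) by algebra
  then show "B = 0" using assms by simp
  have "(n * m' - n' * m) * (m * k' - m' * k) * (k * n' - k' * n) * C = 0"
    using assms(1-3) by algebra
  then show "C = 0" using assms by simp
qed

text \<open>Gives existence and uniqueness of the inconic at once. The equations \<open>dual\<close>
  say that the ellipse with squared semiaxes \<open>D\<close>, \<open>D'\<close> touches the three
  lines; conversely, three tangents in distinct directions determine the dual conic with given
  center up to scale.\<close>

lemma is_inconic_iff:
  fixes c n m k :: point
  assumes lines: "sideline E F = {X. n \<bullet> (X - c) = h}" "sideline F G = {X. m \<bullet> (X - c) = h'}"
      "sideline G E = {X. k \<bullet> (X - c) = h''}"
    and nz: "h \<noteq> 0" "h' \<noteq> 0" "h'' \<noteq> 0"
    and dual: "D * (n$1)\<^sup>2 + D' * (n$2)\<^sup>2 = h\<^sup>2" "D * (m$1)\<^sup>2 + D' * (m$2)\<^sup>2 = h'\<^sup>2"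
      "D * (k$1)\<^sup>2 + D' * (k$2)\<^sup>2 = h''\<^sup>2"
    and cross: "n$1 * m$2 - n$2 * m$1 \<noteq> 0" "m$1 * k$2 - m$2 * k$1 \<noteq> 0" "k$1 * n$2 - k$2 * n$1 \<noteq> 0"
    and pos: "D > 0" "D' > 0"
  shows "is_inconic (E, F, G) c K \<longleftrightarrow> K = {X. (X$1 - c$1)\<^sup>2 / D + (X$2 - c$2)\<^sup>2 / D' = 1}"
proof
  assume "is_inconic (E, F, G) c K"
  then obtain M where M: "transpose M = M" "conic_center M c" and "det M \<noteq> 0" and K: "K = conic M"
    and tangent: "tangent_to_conic {X. n \<bullet> (X - c) = h} M"
      "tangent_to_conic {X. m \<bullet> (X - c) = h'} M" "tangent_to_conic {X. k \<bullet> (X - c) = h''} M"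
    using lines by auto
  define \<delta> where "\<delta> = (M *v hom_coords c)$3"
  define \<Delta> where "\<Delta> = M$1$1 * M$2$2 - (M$1$2)\<^sup>2"
  have \<delta>: "\<delta> \<noteq> 0" and \<Delta>: "\<Delta> \<noteq> 0"
    using \<open>det M \<noteq> 0\<close> unfolding hom_coords_form(2) [OF M] \<delta>_def \<Delta>_def by auto
  have "n \<noteq> 0" "m \<noteq> 0" "k \<noteq> 0"
    using cross by auto
  note t = tangent_dual_form [OF M tangent(1) nz(1) \<open>n \<noteq> 0\<close>, folded \<delta>_def \<Delta>_def]
    tangent_dual_form [OF M tangent(2) nz(2) \<open>m \<noteq> 0\<close>, folded \<delta>_def \<Delta>_def]
    tangent_dual_form [OF M tangent(3) nz(3) \<open>k \<noteq> 0\<close>, folded \<delta>_def \<Delta>_def]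
  \<comment> \<open>The dual form of \<open>M\<close> and that of the ellipse, suitably scaled,
    agree on the three normals; so their difference is the zero form.\<close>
  have "(\<delta> * M$2$2 + \<Delta> * D) * (n$1)\<^sup>2 + (- 2 * \<delta> * M$1$2) * n$1 * n$2 + (\<delta> * M$1$1 + \<Delta> * D') * (n$2)\<^sup>2 = 0"
    "(\<delta> * M$2$2 + \<Delta> * D) * (m$1)\<^sup>2 + (- 2 * \<delta> * M$1$2) * m$1 * m$2 + (\<delta> * M$1$1 + \<Delta> * D') * (m$2)\<^sup>2 = 0"
    "(\<delta> * M$2$2 + \<Delta> * D) * (k$1)\<^sup>2 + (- 2 * \<delta> * M$1$2) * k$1 * k$2 + (\<delta> * M$1$1 + \<Delta> * D') * (k$2)\<^sup>2 = 0"
    using t dual [symmetric] by (simp_all add: algebra_simps)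
  note z = binary_quadratic_form_zero [OF this cross]
  have b: "M$1$2 = 0"
    using z(2) \<delta> by simp
  then have "M$2$2 * (\<delta> + M$1$1 * D) = 0" "M$1$1 * (\<delta> + M$2$2 * D') = 0"
    using z(1,3) by (simp_all add: \<Delta>_def algebra_simps)
  then have ad: "\<delta> = - M$1$1 * D" "\<delta> = - M$2$2 * D'"
    using \<Delta> b by (auto simp: \<Delta>_def)
  have "X \<in> K \<longleftrightarrow> (X$1 - c$1)\<^sup>2 / D + (X$2 - c$2)\<^sup>2 / D' = 1" for X
  proof -
    have "X \<in> K \<longleftrightarrow> M$1$1 * (X$1 - c$1)\<^sup>2 + M$2$2 * (X$2 - c$2)\<^sup>2 + \<delta> = 0"
      unfolding K conic_def mem_Collect_eq hom_coords_form(1) [OF M] b \<delta>_def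
      by (simp add: power2_eq_square mult.assoc)
    also have "M$1$1 * (X$1 - c$1)\<^sup>2 + M$2$2 * (X$2 - c$2)\<^sup>2 + \<delta>
        = \<delta> * (1 - ((X$1 - c$1)\<^sup>2 / D + (X$2 - c$2)\<^sup>2 / D'))"
    proof -
      have "M$1$1 = - \<delta> / D" "M$2$2 = - \<delta> / D'"
        using ad pos by (simp_all add: field_simps)
      then show ?thesis by (simp add: algebra_simps)
    qed
    finally show ?thesis using \<delta> by auto
  qed
  then show "K = {X. (X$1 - c$1)\<^sup>2 / D + (X$2 - c$2)\<^sup>2 / D' = 1}" by auto
next
  assume K: "K = {X. (X$1 - c$1)\<^sup>2 / D + (X$2 - c$2)\<^sup>2 / D' = 1}"
  define e where "e = (c$1)\<^sup>2 / D + (c$2)\<^sup>2 / D' - 1"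
  define M :: "real^3^3" where "M = vector [vector [1 / D, 0, - c$1 / D],
    vector [0, 1 / D', - c$2 / D'], vector [- c$1 / D, - c$2 / D', e]]"
  have entries: "M$1$1 = 1 / D" "M$1$2 = 0" "M$2$2 = 1 / D'"
    by (simp_all add: M_def)
  have M: "transpose M = M" "conic_center M c" and \<delta>: "(M *v hom_coords c)$3 = - 1"
    by (simp_all add: M_def transpose_def vec_eq_iff forall_3 conic_center_def matrix_vector_mult_def
        sum_3 hom_coords_def e_def power2_eq_square)
  note form = hom_coords_form [OF M, unfolded entries \<delta>]
  have "det M \<noteq> 0"
    using pos by (simp add: form(2))
  moreover have "K = conic M"
    unfolding K conic_def form(1) by (simp add: power2_eq_square)
  moreover have "tangent_to_conic {X. n \<bullet> (X - c) = h} M"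
    if "h \<noteq> 0" and dual: "D * (n$1)\<^sup>2 + D' * (n$2)\<^sup>2 = h\<^sup>2" for n h
  proof -
    \<comment> \<open>The point of contact, that is, the pole of the line.\<close>
    define P :: point where "P = vector [c$1 + D * n$1 / h, c$2 + D' * n$2 / h]"
    have eq: "hom_coords X \<bullet> (M *v hom_coords P) = (n \<bullet> (X - c)) / h - 1" for X
      unfolding form(1) using pos by (simp add: P_def inner_point add_divide_distrib mult.commute)
    have "n \<bullet> (P - c) = h"
      using dual \<open>h \<noteq> 0\<close> by (simp add: inner_point P_def field_simps power2_eq_square)
    then have "P \<in> conic M"
      using eq [of P] \<open>h \<noteq> 0\<close> by (simp add: conic_def)
    moreover have "{X. n \<bullet> (X - c) = h} = polar_line M P"
      unfolding polar_line_def eq using \<open>h \<noteq> 0\<close> by auto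
    ultimately show ?thesis
      unfolding tangent_to_conic_def by blast
  qed
  ultimately show "is_inconic (E, F, G) c K"
    using M lines nz dual by auto
qed

subsection \<open>Uniqueness of semiaxes\<close>

lemma orthonormal_parseval:
  fixes u v X :: point
  assumes "norm u = 1" "norm v = 1" "u \<bullet> v = 0"
  shows "(X \<bullet> u)\<^sup>2 + (X \<bullet> v)\<^sup>2 = (norm X)\<^sup>2"
proof -
  have *: "(x * p + y * q)\<^sup>2 + (x * r + y * s)\<^sup>2 = x * x + y * y"
    if "p * p + q * q = 1" "r * r + s * s = 1" "p * r + q * s = 0" for x y p q r s :: real
    using that by algebra
  have "u$1 * u$1 + u$2 * u$2 = 1" "v$1 * v$1 + v$2 * v$2 = 1" "u$1 * v$1 + u$2 * v$2 = 0"
    using assms by (simp_all add: norm_eq_1 inner_point)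
  then show ?thesis
    unfolding power2_norm_eq_inner inner_point by (rule *)
qed

text \<open>Metric data that pin down the semiaxes without mention of axis directions or equations:
  point symmetry, and the extreme distances from the center.\<close>

definition centered_between :: "'a::real_normed_vector \<Rightarrow> real \<Rightarrow> real \<Rightarrow> 'a set \<Rightarrow> bool" where
  "centered_between c q p K \<longleftrightarrow> (\<forall>X\<in>K. q \<le> dist c X \<and> dist c X \<le> p \<and> 2 *\<^sub>R c - X \<in> K)
     \<and> (\<exists>X\<in>K. dist c X = q) \<and> (\<exists>X\<in>K. dist c X = p)"

text \<open>Symmetry about two distinct centers would make \<open>K\<close> invariant under a translation.\<close>

lemma centered_between_unique:
  assumes "centered_between c q p K" "centered_between c' q' p' K"
  shows "p = p' \<and> q = q'"
proof -
  have "c = c'"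
  proof (rule ccontr)
    assume "c \<noteq> c'"
    obtain X where "X \<in> K" using assms(1) by (auto simp: centered_between_def)
    have shift: "X + of_nat n *\<^sub>R (2 *\<^sub>R (c' - c)) \<in> K" for n
    proof (induction n)
      case (Suc n)
      have "2 *\<^sub>R c' - (2 *\<^sub>R c - (X + of_nat n *\<^sub>R (2 *\<^sub>R (c' - c)))) \<in> K"
        using assms Suc unfolding centered_between_def by blast
      then show ?case by (simp add: algebra_simps)
    qed (simp add: \<open>X \<in> K\<close>)
    obtain n where n: "2 * p < of_nat n * norm (2 *\<^sub>R (c' - c))"
      using reals_Archimedean3 \<open>c \<noteq> c'\<close> by (metis norm_eq_zero right_minus_eq scaleR_eq_0_iff zero_less_norm_iff zero_neq_numeral)
    have "dist X (X + of_nat n *\<^sub>R (2 *\<^sub>R (c' - c))) \<le> dist c X + dist c (X + of_nat n *\<^sub>R (2 *\<^sub>R (c' - c)))"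
      by (rule dist_triangle3)
    also have "\<dots> \<le> 2 * p"
    proof -
      have "dist c X \<le> p" "dist c (X + of_nat n *\<^sub>R (2 *\<^sub>R (c' - c))) \<le> p"
        using assms(1) shift [of n] \<open>X \<in> K\<close> unfolding centered_between_def by blast+
      then show ?thesis by simp
    qed
    finally show False using n by (simp add: dist_norm)
  qed
  have "p \<le> p'" "p' \<le> p" "q \<le> q'" "q' \<le> q"
    using assms unfolding \<open>c = c'\<close> centered_between_def by (metis (no_types))+
  then show ?thesis by simp
qed

text \<open>In coordinates along the axes, the equation multiplied by \<open>q\<^sup>2\<close> or by
  \<open>p\<^sup>2\<close> bounds the squared distance from the center below or above; the ends of
  the axes attain the bounds.\<close>

lemma ellipse_centered_between:
  fixes c u v :: point
  assumes "0 < q" "q \<le> p" and orth: "norm u = 1" "norm v = 1" "u \<bullet> v = 0"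
  shows "centered_between c q p {X. ((X - c) \<bullet> u)\<^sup>2 / p\<^sup>2 + ((X - c) \<bullet> v)\<^sup>2 / q\<^sup>2 = 1}"
    (is "centered_between c q p ?K")
proof -
  have "0 < p" using assms by simp
  have "q \<le> dist c X \<and> dist c X \<le> p" if X: "((X - c) \<bullet> u)\<^sup>2 / p\<^sup>2 + ((X - c) \<bullet> v)\<^sup>2 / q\<^sup>2 = 1" for X
  proof -
    define x y where "x = (X - c) \<bullet> u" and "y = (X - c) \<bullet> v"
    have d: "(dist c X)\<^sup>2 = x\<^sup>2 + y\<^sup>2"
      using orthonormal_parseval [OF orth, of "X - c"] by (simp add: x_def y_def dist_norm norm_minus_commute)
    have le: "q\<^sup>2 \<le> p\<^sup>2" using assms by (simp add: power_mono)
    have one: "x\<^sup>2 / p\<^sup>2 + y\<^sup>2 / q\<^sup>2 = 1" using X by (simp add: x_def y_def)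
    have "(q\<^sup>2 / p\<^sup>2) * x\<^sup>2 + y\<^sup>2 = q\<^sup>2 * (x\<^sup>2 / p\<^sup>2 + y\<^sup>2 / q\<^sup>2)" "x\<^sup>2 + (p\<^sup>2 / q\<^sup>2) * y\<^sup>2 = p\<^sup>2 * (x\<^sup>2 / p\<^sup>2 + y\<^sup>2 / q\<^sup>2)"
      using \<open>0 < q\<close> \<open>0 < p\<close> by (simp_all add: distrib_left)
    then have "q\<^sup>2 = (q\<^sup>2 / p\<^sup>2) * x\<^sup>2 + y\<^sup>2" "p\<^sup>2 = x\<^sup>2 + (p\<^sup>2 / q\<^sup>2) * y\<^sup>2"
      using one by simp_all
    moreover have "(q\<^sup>2 / p\<^sup>2) * x\<^sup>2 \<le> 1 * x\<^sup>2" "1 * y\<^sup>2 \<le> (p\<^sup>2 / q\<^sup>2) * y\<^sup>2"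
      using le \<open>0 < q\<close> \<open>0 < p\<close> by (intro mult_right_mono; simp)+
    ultimately have "q\<^sup>2 \<le> (dist c X)\<^sup>2" "(dist c X)\<^sup>2 \<le> p\<^sup>2"
      using d by auto
    then show ?thesis
      using \<open>0 < p\<close> by (auto intro: power2_le_imp_le)
  qed
  then have "\<forall>X\<in>?K. q \<le> dist c X \<and> dist c X \<le> p"
    by simp
  moreover have "((2 *\<^sub>R c - X - c) \<bullet> z)\<^sup>2 = ((X - c) \<bullet> z)\<^sup>2" for X z
  proof -
    have "2 *\<^sub>R c - X - c = - (X - c)" by (simp add: scaleR_2)
    then show ?thesis by (metis inner_minus_left power2_minus)
  qed
  then have "\<forall>X\<in>?K. 2 *\<^sub>R c - X \<in> ?K"
    by simp
  moreover have "c + p *\<^sub>R u \<in> ?K" "c + q *\<^sub>R v \<in> ?K"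
    using orth \<open>0 < p\<close> \<open>0 < q\<close> by (simp_all add: norm_eq_1 inner_commute)
  moreover have "dist c (c + p *\<^sub>R u) = p" "dist c (c + q *\<^sub>R v) = q"
    using orth \<open>0 < p\<close> \<open>0 < q\<close> by (simp_all add: dist_norm)
  ultimately show ?thesis
    unfolding centered_between_def by blast
qed

lemma ellipse_with_semiaxes_unique:
  assumes "ellipse_with_semiaxes p q K" "ellipse_with_semiaxes p' q' K"
  shows "p = p' \<and> q = q'"
proof -
  have "\<exists>c. centered_between c q p K" if "ellipse_with_semiaxes p q K" for p q
  proof -
    from that obtain c u v where "0 < q" "q \<le> p" "norm u = 1" "norm v = 1" "u \<bullet> v = 0"
      and "K = {X. ((X - c) \<bullet> u)\<^sup>2 / p\<^sup>2 + ((X - c) \<bullet> v)\<^sup>2 / q\<^sup>2 = 1}"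
      unfolding ellipse_with_semiaxes_def by blast
    then show ?thesis
      using ellipse_centered_between by blast
  qed
  with assms show ?thesis by (meson centered_between_unique)
qed

lemma semiaxes_eq:
  assumes "ellipse_with_semiaxes p q K"
  shows "major_semiaxis K = p" "minor_semiaxis K = q"
proof -
  have "p' = p \<and> q' = q" if "ellipse_with_semiaxes p' q' K" for p' q'
    using ellipse_with_semiaxes_unique [OF that assms] .
  then show "major_semiaxis K = p" "minor_semiaxis K = q"
    unfolding major_semiaxis_def minor_semiaxis_def using assms by (blast intro: the_equality)+
qed

subsection \<open>The inconic of the excentral triangle\<close>

text \<open>The reflection law between sides \<open>p\<close> and \<open>q\<close> once
  \<open>P = (1 - Q\<^sup>2) / 2\<close> is known. For unit \<open>p\<close>, \<open>q\<close> it
  implies that the ellipse around the Bevan point touches the corresponding excentral side.\<close>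

definition side_relation :: "real \<Rightarrow> complex \<Rightarrow> complex \<Rightarrow> bool" where
  "side_relation Q p q \<longleftrightarrow> (1 - Q) * Re p * Re q + (1 + Q) * Im p * Im q = (Q\<^sup>2 - 1) / 2"

lemma cmod_add_unit:
  assumes "cmod p = 1" "cmod q = 1"
  shows "(cmod (p + q))\<^sup>2 = 2 * (1 + Re (p * cnj q))"
  using assms [THEN arg_cong, of "\<lambda>x. x\<^sup>2"] unfolding cmod_power2
  by (simp add: power2_eq_square algebra_simps)

text \<open>The side has direction \<open>\<i> (p - q)\<close>. Sum and difference of unit vectors
  are orthogonal, so \<open>\<i> (p + q)\<close> is a normal.\<close>

lemma sideline_bevan:
  assumes "cmod p = 1" "cmod q = 1" "p \<noteq> q" "p + q \<noteq> 0" "t \<noteq> 0"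
  shows "sideline (pt (e + 2 * \<i> * of_real t * p)) (pt (e + 2 * \<i> * of_real t * q))
    = {X. pt (\<i> * (p + q)) \<bullet> (X - pt e) = 2 * t * (1 + Re (p * cnj q))}"
proof -
  have "pt (\<i> * (p + q)) \<bullet> (pt (e + 2 * \<i> * of_real t * r) - pt e) = 2 * t * Re ((p + q) * cnj r)" for r
    by (simp add: inner_pt algebra_simps flip: pt_diff)
  moreover have "Re ((p + q) * cnj p) = 1 + Re (p * cnj q)" "Re ((p + q) * cnj q) = 1 + Re (p * cnj q)"
    using assms(1,2) [THEN arg_cong, of "\<lambda>x. x\<^sup>2"] unfolding cmod_power2
    by (simp_all add: power2_eq_square algebra_simps)
  ultimately have "pt (\<i> * (p + q)) \<bullet> (pt (e + 2 * \<i> * of_real t * p) - pt e) = 2 * t * (1 + Re (p * cnj q))"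
    "pt (\<i> * (p + q)) \<bullet> (pt (e + 2 * \<i> * of_real t * q) - pt e) = 2 * t * (1 + Re (p * cnj q))"
    by presburger+
  then have "pt (\<i> * (p + q)) \<bullet> pt (e + 2 * \<i> * of_real t * p) = pt (\<i> * (p + q)) \<bullet> pt e + 2 * t * (1 + Re (p * cnj q))"
    "pt (\<i> * (p + q)) \<bullet> pt (e + 2 * \<i> * of_real t * q) = pt (\<i> * (p + q)) \<bullet> pt e + 2 * t * (1 + Re (p * cnj q))"
    unfolding inner_diff_right by linarith+
  moreover have "pt (e + 2 * \<i> * of_real t * p) \<noteq> pt (e + 2 * \<i> * of_real t * q)" "pt (\<i> * (p + q)) \<noteq> 0"
    using assms(3-5) unfolding pt_0 [symmetric] pt_eq_iff by simp_all
  ultimately show ?thesis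
    by (simp add: sideline_eq inner_diff_right diff_eq_eq add.commute)
qed

text \<open>The tangency equation required by \<open>is_inconic_iff\<close>. With
  \<open>c = 1 + Re (p cnj q)\<close> and \<open>d = Re (p q)\<close> the left side is
  \<open>2 c (1 + Q\<^sup>2 + 2 Q d)\<close> up to the factor \<open>t\<^sup>2\<close>, and the side
  relation reads \<open>1 + Q\<^sup>2 + 2 Q d = 2 c\<close>.\<close>

lemma side_relation_dual:
  assumes "side_relation Q p q" "cmod p = 1" "cmod q = 1"
  shows "t\<^sup>2 * (1 - Q)\<^sup>2 * (pt (\<i> * (p + q)) $ 1)\<^sup>2 + t\<^sup>2 * (1 + Q)\<^sup>2 * (pt (\<i> * (p + q)) $ 2)\<^sup>2
    = (2 * t * (1 + Re (p * cnj q)))\<^sup>2"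
proof -
  have *: "(1 - Q)\<^sup>2 * (p2 + q2)\<^sup>2 + (1 + Q)\<^sup>2 * (p1 + q1)\<^sup>2 = 4 * (1 + (p1 * q1 + p2 * q2))\<^sup>2"
    if unit: "p1\<^sup>2 + p2\<^sup>2 = 1" "q1\<^sup>2 + q2\<^sup>2 = 1"
      and rel: "2 * ((1 - Q) * p1 * q1 + (1 + Q) * p2 * q2) = Q\<^sup>2 - 1" for p1 p2 q1 q2
  proof -
    define c d where "c = 1 + (p1 * q1 + p2 * q2)" and "d = p1 * q1 - p2 * q2"
    have "(p1 + q1)\<^sup>2 + (p2 + q2)\<^sup>2 = 2 * (1 + (p1 * q1 + p2 * q2))"
      using unit by algebra
    moreover have "(p1 + q1)\<^sup>2 - (p2 + q2)\<^sup>2 = 2 * (1 + (p1 * q1 + p2 * q2)) * (p1 * q1 - p2 * q2)"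
      using unit by algebra
    moreover have "1 + Q\<^sup>2 + 2 * Q * (p1 * q1 - p2 * q2) = 2 * (1 + (p1 * q1 + p2 * q2))"
      using rel by (simp add: algebra_simps)
    moreover have "(1 - Q)\<^sup>2 * (p2 + q2)\<^sup>2 + (1 + Q)\<^sup>2 * (p1 + q1)\<^sup>2
        = (1 + Q\<^sup>2) * ((p1 + q1)\<^sup>2 + (p2 + q2)\<^sup>2) + 2 * Q * ((p1 + q1)\<^sup>2 - (p2 + q2)\<^sup>2)"
      by (simp add: power2_eq_square algebra_simps)
    ultimately have lhs: "(1 - Q)\<^sup>2 * (p2 + q2)\<^sup>2 + (1 + Q)\<^sup>2 * (p1 + q1)\<^sup>2
        = (1 + Q\<^sup>2) * (2 * c) + 2 * Q * (2 * c * d)" and cd: "1 + Q\<^sup>2 + 2 * Q * d = 2 * c"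
      unfolding c_def d_def by presburger+
    have "(1 - Q)\<^sup>2 * (p2 + q2)\<^sup>2 + (1 + Q)\<^sup>2 * (p1 + q1)\<^sup>2 = 2 * c * (1 + Q\<^sup>2 + 2 * Q * d)"
      unfolding lhs by (simp add: algebra_simps)
    also have "\<dots> = 4 * (1 + (p1 * q1 + p2 * q2))\<^sup>2"
      unfolding cd c_def [symmetric] by (simp add: power2_eq_square)
    finally show ?thesis .
  qed
  have "(Re p)\<^sup>2 + (Im p)\<^sup>2 = 1" "(Re q)\<^sup>2 + (Im q)\<^sup>2 = 1"
    using assms(2,3) by (simp_all flip: cmod_power2)
  then have "(1 - Q)\<^sup>2 * (Im p + Im q)\<^sup>2 + (1 + Q)\<^sup>2 * (Re p + Re q)\<^sup>2
      = 4 * (1 + (Re p * Re q + Im p * Im q))\<^sup>2"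
    using assms(1) by (intro *) (simp_all add: side_relation_def)
  moreover have "(pt (\<i> * (p + q)) $ 1)\<^sup>2 = (Im p + Im q)\<^sup>2" "(pt (\<i> * (p + q)) $ 2)\<^sup>2 = (Re p + Re q)\<^sup>2"
    by (simp_all add: power2_eq_square algebra_simps)
  moreover have "(2 * t * (1 + Re (p * cnj q)))\<^sup>2 = t\<^sup>2 * (4 * (1 + (Re p * Re q + Im p * Im q))\<^sup>2)"
    by (simp add: power_mult_distrib)
  ultimately show ?thesis
    by (simp only: mult.assoc flip: distrib_left)
qed

lemma is_inconic_excentral_framed:
  assumes f: "frame u v w t" and Q: "\<bar>Q\<bar> < 1"
    and rel: "side_relation Q u v" "side_relation Q v w" "side_relation Q w u"
  shows "is_inconic (excentral (framed_triangle m t u v w))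
      (circumcenter (excentral (framed_triangle m t u v w))) K \<longleftrightarrow>
    K = {X. (X$1 - pt (bevan m t u v w)$1)\<^sup>2 / (t\<^sup>2 * (1 - Q)\<^sup>2)
          + (X$2 - pt (bevan m t u v w)$2)\<^sup>2 / (t\<^sup>2 * (1 + Q)\<^sup>2) = 1}"
proof -
  note f2 = frame_cycle [OF f]
  note f3 = frame_cycle [OF f2]
  note d = frame_distinct [OF f]
  have unit: "cmod u = 1" "cmod v = 1" "cmod w = 1"
    using f by (auto simp: frame_def)
  have nz: "2 * t * (1 + Re (p * cnj q)) \<noteq> 0" if "cmod p = 1" "cmod q = 1" "p + q \<noteq> 0" for p q
  proof -
    have "(cmod (p + q))\<^sup>2 \<noteq> 0" using that by simp
    then have "1 + Re (p * cnj q) \<noteq> 0" unfolding cmod_add_unit [OF that(1,2)] by (metis mult_zero_right)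
    then show ?thesis using d(7) by simp
  qed
  have cross: "pt (\<i> * p) $ 1 * pt (\<i> * q) $ 2 - pt (\<i> * p) $ 2 * pt (\<i> * q) $ 1 \<noteq> 0"
    if "Im (q * cnj p) \<noteq> 0" for p q
    using that by (simp add: algebra_simps)
  have "Im ((w + u) * cnj (v + w)) \<noteq> 0" "Im ((u + v) * cnj (w + u)) \<noteq> 0" "Im ((v + w) * cnj (u + v)) \<noteq> 0"
    using frame_not_parallel(2) [OF f] frame_not_parallel(2) [OF f2] frame_not_parallel(2) [OF f3]
    unfolding Im_0_iff_cnj by (simp_all add: ac_simps)
  note cross = this [THEN cross]
  show ?thesis
    unfolding circumcenter_excentral_framed [OF f] unfolding excentral_framed [OF f]
    using d Q
    by (intro is_inconic_iff [OF sideline_bevan sideline_bevan sideline_bevan nz nz nz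
          side_relation_dual side_relation_dual side_relation_dual cross])
      (auto simp: unit rel)
qed

lemma semiaxes_framed:
  assumes f: "frame u v w t" and Q: "0 < Q" "Q < 1"
    and rel: "side_relation Q u v" "side_relation Q v w" "side_relation Q w u"
  shows "ellipse_with_semiaxes (\<bar>t\<bar> * (1 + Q)) (\<bar>t\<bar> * (1 - Q)) (excentral_inconic (framed_triangle m t u v w))"
proof -
  have "\<bar>Q\<bar> < 1" using Q by simp
  note iff = is_inconic_excentral_framed [OF f this rel, of m]
  have K: "excentral_inconic (framed_triangle m t u v w) =
      {X. (X$1 - pt (bevan m t u v w)$1)\<^sup>2 / (t\<^sup>2 * (1 - Q)\<^sup>2)
        + (X$2 - pt (bevan m t u v w)$2)\<^sup>2 / (t\<^sup>2 * (1 + Q)\<^sup>2) = 1}"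
    unfolding excentral_inconic_def inconic_def iff by simp
  have "t \<noteq> 0" using frame_distinct [OF f] by simp
  then have "0 < \<bar>t\<bar> * (1 - Q)" "\<bar>t\<bar> * (1 - Q) \<le> \<bar>t\<bar> * (1 + Q)"
    using Q by (simp_all add: mult_left_mono)
  \<comment> \<open>Since \<open>Q > 0\<close>, the vertical semiaxis is the longer one, so
    \<open>pt \<i>\<close> directs the major axis.\<close>
  moreover have "excentral_inconic (framed_triangle m t u v w) =
      {X. ((X - pt (bevan m t u v w)) \<bullet> pt \<i>)\<^sup>2 / (\<bar>t\<bar> * (1 + Q))\<^sup>2
        + ((X - pt (bevan m t u v w)) \<bullet> pt 1)\<^sup>2 / (\<bar>t\<bar> * (1 - Q))\<^sup>2 = 1}"
    unfolding K by (simp add: inner_point power_mult_distrib add.commute)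
  moreover have "pt \<i> \<bullet> pt 1 = 0" "norm (pt \<i>) = 1" "norm (pt 1) = 1"
    by (simp_all add: inner_pt)
  ultimately show ?thesis
    unfolding ellipse_with_semiaxes_def by blast
qed

text \<open>For nonzero \<open>k\<close> the condition describes a line, which meets the unit circle
  at most twice. Multiplied by \<open>2 z\<close> it becomes quadratic in \<open>z\<close>, and
  three distinct roots force \<open>k = 0\<close>.\<close>

lemma unit_circle_line:
  assumes unit: "cmod p = 1" "cmod q = 1" "cmod r = 1" and "p \<noteq> q" "q \<noteq> r" "r \<noteq> p"
    and line: "Re (cnj k * p) = \<alpha>" "Re (cnj k * q) = \<alpha>" "Re (cnj k * r) = \<alpha>"
  shows "k = 0" "\<alpha> = 0"
proof -
  have quad: "cnj k * z\<^sup>2 - 2 * of_real \<alpha> * z + k = 0" if "cmod z = 1" "Re (cnj k * z) = \<alpha>" for z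
  proof -
    have "2 * of_real \<alpha> = cnj k * z + k * cnj z"
      unfolding that(2) [symmetric] by (simp add: complex_eq_iff)
    then have "2 * of_real \<alpha> * z = cnj k * z\<^sup>2 + k * (z * cnj z)"
      by (simp add: power2_eq_square algebra_simps)
    then show ?thesis
      unfolding cnj_mult_unit [OF that(1)] by simp
  qed
  note eqs = quad [OF unit(1) line(1)] quad [OF unit(2) line(2)] quad [OF unit(3) line(3)]
  have expand: "(x - y) * (cnj k * (x + y) - 2 * of_real \<alpha>)
      = (cnj k * x\<^sup>2 - 2 * of_real \<alpha> * x + k) - (cnj k * y\<^sup>2 - 2 * of_real \<alpha> * y + k)" for x y
    by (simp add: power2_eq_square algebra_simps)
  have "(p - q) * (cnj k * (p + q) - 2 * of_real \<alpha>) = 0" "(r - q) * (cnj k * (r + q) - 2 * of_real \<alpha>) = 0"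
    unfolding expand eqs by simp_all
  then have "cnj k * (p + q) = 2 * of_real \<alpha>" "cnj k * (r + q) = 2 * of_real \<alpha>"
    using \<open>p \<noteq> q\<close> \<open>q \<noteq> r\<close> by auto
  then have "cnj k * (p + q) = cnj k * (r + q)"
    by (simp only:)
  then have "cnj k = 0 \<or> p + q = r + q"
    by (simp only: mult_cancel_left)
  then show "k = 0" using \<open>r \<noteq> p\<close> by simp
  then show "\<alpha> = 0" using line by simp
qed

text \<open>Multiplying \<open>cnj e\<close> by \<open>u v\<close>, \<open>v w\<close> or
  \<open>w u\<close> turns the three conditions into one linear condition with common right-hand
  side \<open>P + 1 + S\<close>, so \<open>unit_circle_line\<close> applies with
  \<open>k = Q + e\<close>. Since conjugation inverts unit numbers, \<open>e\<close> and
  \<open>u + v + w\<close> have equal modulus.\<close>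

lemma side_relation_closure:
  assumes unit: "cmod u = 1" "cmod v = 1" "cmod w = 1" and "u \<noteq> v" "v \<noteq> w" "w \<noteq> u"
    and rel: "(1 - Q) * Re u * Re v + (1 + Q) * Im u * Im v = - P"
      "(1 - Q) * Re v * Re w + (1 + Q) * Im v * Im w = - P"
      "(1 - Q) * Re w * Re u + (1 + Q) * Im w * Im u = - P"
  shows "P = (1 - Q\<^sup>2) / 2" "(cmod (u + v + w))\<^sup>2 = Q\<^sup>2"
proof -
  define e where "e = u * v + v * w + w * u"
  define S where "S = Re (u * cnj v) + Re (v * cnj w) + Re (w * cnj u)"
  note cnj = unit [THEN cnj_mult_unit]
  have e: "cnj e * (u * v) = 1 + u * cnj w + v * cnj w"
    "cnj e * (v * w) = 1 + v * cnj u + w * cnj u" "cnj e * (w * u) = 1 + w * cnj v + u * cnj v"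
    unfolding e_def using cnj by (simp, algebra)+
  have "Re (cnj (of_real Q + e) * (u * v)) = P + 1 + S"
    "Re (cnj (of_real Q + e) * (v * w)) = P + 1 + S"
    "Re (cnj (of_real Q + e) * (w * u)) = P + 1 + S"
    using rel unfolding complex_cnj_add distrib_right e S_def by (simp_all add: algebra_simps)
  moreover have "u \<noteq> 0" "v \<noteq> 0" "w \<noteq> 0"
    using unit by auto
  then have "u * v \<noteq> v * w" "v * w \<noteq> w * u" "w * u \<noteq> u * v"
    using assms(4-6) by simp_all
  moreover have "cmod (u * v) = 1" "cmod (v * w) = 1" "cmod (w * u) = 1"
    using unit by (simp_all add: norm_mult)
  ultimately have "of_real Q + e = 0" "P + 1 + S = 0"
    using unit_circle_line by blast+
  then have "cmod e = \<bar>Q\<bar>"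
    by (metis add_eq_0_iff norm_minus_cancel norm_of_real)
  moreover have "e = u * v * w * cnj (u + v + w)"
    unfolding e_def using cnj by simp algebra
  ultimately have "cmod (u + v + w) = \<bar>Q\<bar>"
    using unit by (simp add: norm_mult del: complex_cnj_add)
  then show "(cmod (u + v + w))\<^sup>2 = Q\<^sup>2"
    by simp
  moreover have "(cmod (u + v + w))\<^sup>2 = 3 + 2 * S"
    using unit [THEN arg_cong, of "\<lambda>x. x\<^sup>2"] unfolding cmod_power2 S_def
    by (simp add: power2_eq_square algebra_simps)
  ultimately show "P = (1 - Q\<^sup>2) / 2"
    using \<open>P + 1 + S = 0\<close> by simp
qed

subsection \<open>The reflection law\<close>

definition ellipse_grad :: "real \<Rightarrow> real \<Rightarrow> complex \<Rightarrow> complex" where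
  "ellipse_grad a b z = Complex (Re z / a\<^sup>2) (Im z / b\<^sup>2)"

lemma ellipse_grad_sel [simp]:
  "Re (ellipse_grad a b z) = Re z / a\<^sup>2" "Im (ellipse_grad a b z) = Im z / b\<^sup>2"
  by (simp_all add: ellipse_grad_def)

lemma ellipse_normal_pt: "ellipse_normal a b (pt z) = line_dir (pt z) (pt (ellipse_grad a b z))"
  by (simp add: ellipse_normal_def pt_def)

lemma pt_in_billiard_ellipse: "pt z \<in> billiard_ellipse a b \<longleftrightarrow> z \<bullet> ellipse_grad a b z = 1"
  by (simp add: billiard_ellipse_def inner_complex_def power2_eq_square)

text \<open>The map \<open>ellipse_grad a b\<close> is linear and symmetric, so the inner product of
  \<open>y - x\<close> with the sum of the two gradients is the difference of the two ellipse
  equations.\<close>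

lemma chord_law:
  assumes "x \<bullet> ellipse_grad a b x = 1" "y \<bullet> ellipse_grad a b y = 1"
    and "y - x = of_real c * u" "c \<noteq> 0"
  shows "u \<bullet> ellipse_grad a b y = - (u \<bullet> ellipse_grad a b x)"
proof -
  have "c * (u \<bullet> ellipse_grad a b x + u \<bullet> ellipse_grad a b y) = (y - x) \<bullet> (ellipse_grad a b x + ellipse_grad a b y)"
    unfolding assms(3) by (simp add: inner_complex_def algebra_simps)
  also have "\<dots> = 0"
    using assms(1,2) by (simp add: inner_complex_def algebra_simps add_divide_distrib diff_divide_distrib)
  finally show ?thesis using \<open>c \<noteq> 0\<close> by simp
qed

text \<open>Pairing \<open>reflect\<close> with \<open>u + v\<close> gives the first claim, pairing
  it with \<open>u\<close> gives \<open>k J = u \<bullet> v - 1\<close>. Inserting the gradient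
  \<open>(v - u) / k\<close> into the ellipse equation and eliminating \<open>k\<close> leaves the
  second claim, free of \<open>z\<close> except through \<open>J\<close>.\<close>

lemma reflection_law:
  assumes ab: "a \<noteq> 0" "b \<noteq> 0" and z: "z \<bullet> ellipse_grad a b z = 1"
    and unit: "cmod u = 1" "cmod v = 1" and "u \<noteq> v"
    and reflect: "v - u = of_real k * ellipse_grad a b z"
  shows "v \<bullet> ellipse_grad a b z = - (u \<bullet> ellipse_grad a b z)"
    and "(u \<bullet> ellipse_grad a b z)\<^sup>2 * (a\<^sup>2 + b\<^sup>2 - (a\<^sup>2 - b\<^sup>2) * (Re u * Re v - Im u * Im v)) = 1 - u \<bullet> v"
    and "u \<bullet> v \<noteq> 1"
proof -
  let ?g = "ellipse_grad a b z"
  define J s m where "J = u \<bullet> ?g" and "s = u \<bullet> v" and "m = Re u * Re v - Im u * Im v"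
  have "k \<noteq> 0" using reflect \<open>u \<noteq> v\<close> by auto
  have uu: "u \<bullet> u = 1" "v \<bullet> v = 1"
    using unit by (simp_all add: norm_eq_1)
  have k: "k * (x \<bullet> ?g) = x \<bullet> (v - u)" for x
    unfolding reflect by (simp add: inner_complex_def algebra_simps)
  have "k * (v \<bullet> ?g + u \<bullet> ?g) = (v + u) \<bullet> (v - u)"
    using k [of "v + u"] by (simp add: inner_add_left)
  also have "\<dots> = 0"
    using uu by (simp add: inner_simps inner_commute)
  finally show "v \<bullet> ?g = - (u \<bullet> ?g)"
    using \<open>k \<noteq> 0\<close> by (simp add: eq_neg_iff_add_eq_0)
  have "(v - u) \<bullet> (v - u) = 2 * (1 - s)"
    unfolding s_def using uu by (simp add: inner_simps inner_commute)
  then have "s \<noteq> 1" using \<open>u \<noteq> v\<close> by auto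
  then show "u \<bullet> v \<noteq> 1" by (simp add: s_def)
  have kJ: "k * J = s - 1"
    unfolding J_def k s_def using uu by (simp add: inner_simps)
  \<comment> \<open>For unit vectors the squared coordinates of \<open>v - u\<close> are
    \<open>(1 - s) (1 - m)\<close> and \<open>(1 - s) (1 + m)\<close>.\<close>
  have eq: "\<alpha> * (v1 - u1)\<^sup>2 + \<beta> * (v2 - u2)\<^sup>2
      = (1 - (u1 * v1 + u2 * v2)) * (\<alpha> + \<beta> - (\<alpha> - \<beta>) * (u1 * v1 - u2 * v2))"
    if u: "u1 * u1 + u2 * u2 = 1" and v: "v1 * v1 + v2 * v2 = 1" for \<alpha> \<beta> u1 u2 v1 v2 :: real
  proof -
    have sum: "(v1 - u1)\<^sup>2 + (v2 - u2)\<^sup>2 = 2 * (1 - (u1 * v1 + u2 * v2))"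
      using u v by algebra
    have diff: "(v1 - u1)\<^sup>2 - (v2 - u2)\<^sup>2 = - 2 * (1 - (u1 * v1 + u2 * v2)) * (u1 * v1 - u2 * v2)"
      using u v by algebra
    have "\<alpha> * (v1 - u1)\<^sup>2 + \<beta> * (v2 - u2)\<^sup>2
      = ((\<alpha> + \<beta>) * ((v1 - u1)\<^sup>2 + (v2 - u2)\<^sup>2) + (\<alpha> - \<beta>) * ((v1 - u1)\<^sup>2 - (v2 - u2)\<^sup>2)) / 2"
      by (simp add: field_simps)
    then show ?thesis
      unfolding sum diff by (simp add: field_simps)
  qed
  have sq: "a\<^sup>2 * (Re v - Re u)\<^sup>2 + b\<^sup>2 * (Im v - Im u)\<^sup>2 = (1 - s) * (a\<^sup>2 + b\<^sup>2 - (a\<^sup>2 - b\<^sup>2) * m)"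
    unfolding s_def m_def inner_complex_def
    using uu by (intro eq) (simp_all add: inner_complex_def)
  have "Re v - Re u = k * (Re z / a\<^sup>2)" "Im v - Im u = k * (Im z / b\<^sup>2)"
    using arg_cong [OF reflect, of Re] arg_cong [OF reflect, of Im] by simp_all
  moreover have "c\<^sup>2 * (k * (x / c\<^sup>2))\<^sup>2 = k\<^sup>2 * (x * (x / c\<^sup>2))" if "c \<noteq> 0" for c x
    using that by (simp add: power2_eq_square)
  ultimately have "a\<^sup>2 * (Re v - Re u)\<^sup>2 + b\<^sup>2 * (Im v - Im u)\<^sup>2 = k\<^sup>2 * (z \<bullet> ?g)"
    using ab by (simp add: inner_complex_def distrib_left)
  with sq have "J\<^sup>2 * ((1 - s) * (a\<^sup>2 + b\<^sup>2 - (a\<^sup>2 - b\<^sup>2) * m)) = (k * J)\<^sup>2"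
    unfolding z by (simp add: power_mult_distrib)
  also have "\<dots> = (1 - s) * (1 - s)"
    unfolding kJ by (simp add: power2_eq_square algebra_simps)
  finally have "(1 - s) * (J\<^sup>2 * (a\<^sup>2 + b\<^sup>2 - (a\<^sup>2 - b\<^sup>2) * m)) = (1 - s) * (1 - s)"
    by (simp only: mult.left_commute)
  then have "J\<^sup>2 * (a\<^sup>2 + b\<^sup>2 - (a\<^sup>2 - b\<^sup>2) * m) = 1 - s"
    using \<open>s \<noteq> 1\<close> unfolding mult_cancel_left by simp
  then show "(u \<bullet> ?g)\<^sup>2 * (a\<^sup>2 + b\<^sup>2 - (a\<^sup>2 - b\<^sup>2) * (Re u * Re v - Im u * Im v)) = 1 - u \<bullet> v"
    by (simp add: J_def s_def m_def)
qed

lemma three_periodic_framed: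
  assumes "0 < b" "b < a" and T: "T \<in> three_periodics a b"
  obtains m t u v w Q where "T = framed_triangle m t u v w" "frame u v w t" "0 < Q" "Q < 1"
    "side_relation Q u v" "side_relation Q v w" "side_relation Q w u" "(cmod (u + v + w))\<^sup>2 = Q\<^sup>2"
    "(3 - Q\<^sup>2) * (a\<^sup>2 - b\<^sup>2) = 2 * Q * (a\<^sup>2 + b\<^sup>2)"
proof -
  obtain A B C where T_eq: "T = (A, B, C)" and "\<not> collinear {A, B, C}"
    and mem: "A \<in> billiard_ellipse a b" "B \<in> billiard_ellipse a b" "C \<in> billiard_ellipse a b"
    and normals: "ellipse_normal a b A = internal_bisector A B C"
      "ellipse_normal a b B = internal_bisector B C A" "ellipse_normal a b C = internal_bisector C A B"
    using T by (auto simp: three_periodics_def)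
  then obtain m t u v w where f: "frame u v w t" and ABC: "(A, B, C) = framed_triangle m t u v w"
    using framed_triangle_exists by metis
  note f2 = frame_cycle [OF f]
  note f3 = frame_cycle [OF f2]
  note d = frame_distinct [OF f]
  have unit: "cmod u = 1" "cmod v = 1" "cmod w = 1"
    using f by (auto simp: frame_def)
  define x y z where "x = corner m t w u v" and "y = corner m t u v w" and "z = corner m t v w u"
  have [simp]: "A = pt x" "B = pt y" "C = pt z"
    using ABC by (simp_all add: framed_triangle_def x_def y_def z_def)
  let ?G = "ellipse_grad a b"
  have ell: "x \<bullet> ?G x = 1" "y \<bullet> ?G y = 1" "z \<bullet> ?G z = 1"
    using mem by (simp_all add: pt_in_billiard_ellipse)
  have ab: "a \<noteq> 0" "b \<noteq> 0" using assms by auto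
  have parallel: "\<exists>k. q = of_real k * ?G p" if eq: "line_dir (pt p) (pt (?G p)) = line_dir (pt p) (pt q)" for p q
  proof -
    obtain k where "pt q = k *\<^sub>R pt (?G p)"
      by (rule mem_line_dir_multiple [OF eq])
    then show ?thesis
      by (auto simp flip: pt_of_real_mult)
  qed
  have "line_dir (pt x) (pt (?G x)) = line_dir (pt x) (pt (u - w))"
    "line_dir (pt y) (pt (?G y)) = line_dir (pt y) (pt (v - u))"
    "line_dir (pt z) (pt (?G z)) = line_dir (pt z) (pt (w - v))"
    using normals bisectors_framed(1) [OF f, of m] bisectors_framed(1) [OF f2, of m] bisectors_framed(1) [OF f3, of m]
    by (simp_all add: ellipse_normal_pt x_def y_def z_def)
  then obtain kA kB kC where kA: "u - w = of_real kA * ?G x" and kB: "v - u = of_real kB * ?G y"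
    and kC: "w - v = of_real kC * ?G z"
    using parallel by meson
  note law = reflection_law [OF ab ell(1) unit(3,1) d(3) kA]
    reflection_law [OF ab ell(2) unit(1,2) d(1) kB] reflection_law [OF ab ell(3) unit(2,3) d(2) kC]
  have nz: "2 * t * Im (v * cnj w) \<noteq> 0" "2 * t * Im (w * cnj u) \<noteq> 0"
    using f by (auto simp: frame_def)
  define J where "J = u \<bullet> ?G x"
  \<comment> \<open>The product changes sign along a side by \<open>chord_law\<close> and changes
    back at the bounce by the reflection law.\<close>
  have J: "u \<bullet> ?G y = - J" "v \<bullet> ?G z = - J" "w \<bullet> ?G x = - J"
    using law(1,4) chord_law [OF ell(1,2) corner_diff [OF unit(1), of m t v w, folded x_def y_def] nz(1)]
      chord_law [OF ell(2,3) corner_diff [OF unit(2), of m t w u, folded y_def z_def] nz(2)]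
    by (simp_all add: J_def)
  define P Q where "P = J\<^sup>2 * (a\<^sup>2 + b\<^sup>2) - 1" and "Q = J\<^sup>2 * (a\<^sup>2 - b\<^sup>2)"
  have rel: "(1 - Q) * Re u * Re v + (1 + Q) * Im u * Im v = - P"
    "(1 - Q) * Re v * Re w + (1 + Q) * Im v * Im w = - P"
    "(1 - Q) * Re w * Re u + (1 + Q) * Im w * Im u = - P"
    using law(2,5,8) unfolding J by (simp_all add: P_def Q_def inner_complex_def algebra_simps)
  note closure = side_relation_closure [OF unit d(1-3) rel]
  have "J \<noteq> 0"
    using law(2,3) J(3) by auto
  moreover have "b\<^sup>2 < a\<^sup>2"
    using assms(1,2) by (intro power_strict_mono) auto
  ultimately have "0 < Q"
    by (simp add: Q_def)
  have PQ: "J\<^sup>2 * (a\<^sup>2 + b\<^sup>2) = (3 - Q\<^sup>2) / 2"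
    using closure(1) by (simp add: P_def field_simps)
  \<comment> \<open>\<open>Q\<close> differs from \<open>J\<^sup>2 (a\<^sup>2 + b\<^sup>2)\<close>
    by \<open>2 J\<^sup>2 b\<^sup>2\<close>. The right side is at most 1 once
    \<open>Q \<ge> 1\<close>, hence \<open>Q < 1\<close>.\<close>
  have "Q < (3 - Q\<^sup>2) / 2"
    unfolding PQ [symmetric] unfolding Q_def using \<open>J \<noteq> 0\<close> \<open>b \<noteq> 0\<close> by (simp add: algebra_simps)
  have "Q < 1"
  proof (rule ccontr)
    assume "\<not> Q < 1"
    then have "1 \<le> Q" "1 \<le> Q\<^sup>2" by simp_all
    with \<open>Q < (3 - Q\<^sup>2) / 2\<close> show False by (simp add: field_simps)
  qed
  have "J\<^sup>2 * ((3 - Q\<^sup>2) * (a\<^sup>2 - b\<^sup>2)) = (3 - Q\<^sup>2) * Q"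
    by (simp add: Q_def)
  also have "\<dots> = 2 * Q * ((3 - Q\<^sup>2) / 2)"
    by simp
  also have "\<dots> = J\<^sup>2 * (2 * Q * (a\<^sup>2 + b\<^sup>2))"
    unfolding PQ [symmetric] by simp
  finally have "(3 - Q\<^sup>2) * (a\<^sup>2 - b\<^sup>2) = 2 * Q * (a\<^sup>2 + b\<^sup>2)"
    using \<open>J \<noteq> 0\<close> unfolding mult_cancel_left by simp
  moreover have "- P = (Q\<^sup>2 - 1) / 2"
    using closure(1) by (simp add: field_simps)
  then have "side_relation Q u v" "side_relation Q v w" "side_relation Q w u"
    using rel unfolding side_relation_def by simp_all
  ultimately show ?thesis
    using that T_eq ABC f \<open>0 < Q\<close> \<open>Q < 1\<close> closure(2) by simp
qed

subsection \<open>The isosceles 3-periodics\<close>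

text \<open>Each corner is paired with the direction of its internal bisector; a nonzero
  \<open>k\<close> makes this bisector and the normal the same line.\<close>

definition framed_periodic ::
    "real \<Rightarrow> real \<Rightarrow> complex \<Rightarrow> real \<Rightarrow> complex \<Rightarrow> complex \<Rightarrow> complex \<Rightarrow> bool" where
  "framed_periodic a b m t u v w \<longleftrightarrow> frame u v w t
     \<and> (\<forall>(z, d) \<in> {(corner m t w u v, u - w), (corner m t u v w, v - u), (corner m t v w u, w - v)}.
          z \<bullet> ellipse_grad a b z = 1 \<and> (\<exists>k. k \<noteq> 0 \<and> d = of_real k * ellipse_grad a b z))"

text \<open>Collinear corners would make \<open>v\<close> a real multiple of \<open>u\<close>,
  against \<open>Im (u cnj v) \<noteq> 0\<close>.\<close>

lemma frame_not_collinear: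
  assumes f: "frame u v w t"
  shows "\<not> collinear {pt (corner m t w u v), pt (corner m t u v w), pt (corner m t v w u)}"
proof
  let ?x = "corner m t w u v" and ?y = "corner m t u v w" and ?z = "corner m t v w u"
  assume col: "collinear {pt ?x, pt ?y, pt ?z}"
  have unit: "cmod u = 1" "cmod v = 1" and pos: "t * Im (v * cnj w) > 0" "t * Im (w * cnj u) > 0" "t * Im (u * cnj v) > 0"
    using f by (auto simp: frame_def)
  from pos(3) have "Im (u * cnj v) \<noteq> 0"
    by (metis less_irrefl mult_zero_right)
  then have vu: "Im (v * cnj u) \<noteq> 0"
    by (simp add: algebra_simps)
  from unit have e: "?y - ?x = of_real (2 * t * Im (v * cnj w)) * u" "?z - ?y = of_real (2 * t * Im (w * cnj u)) * v"
    by (simp_all only: corner_diff)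
  have "?x \<noteq> ?y"
    using e(1) pos(1) unit(1) by (metis diff_self mult_eq_0_iff norm_zero of_real_eq_0_iff zero_neq_one
        less_irrefl mult.assoc zero_neq_numeral)
  then have "pt ?z \<in> line_dir (pt ?x) (pt (?y - ?x))"
    using col by (simp add: collinear_3_affine_hull sideline_def flip: sideline_line_dir)
  then obtain s where "?z = ?x + s *\<^sub>R (?y - ?x)"
    unfolding line_dir_def by (auto simp flip: pt_add pt_scaleR)
  then have "?z - ?y = of_real (s - 1) * (?y - ?x)"
    by (simp add: scaleR_conv_of_real algebra_simps)
  then have "of_real (2 * t * Im (w * cnj u)) * v = of_real ((s - 1) * (2 * t * Im (v * cnj w))) * u"
    unfolding e by simp
  then have "2 * t * Im (w * cnj u) * Im (v * cnj u) = (s - 1) * (2 * t * Im (v * cnj w)) * Im (u * cnj u)"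
    by (metis Im_complex_of_real Re_complex_of_real add_0_right mult.assoc mult_zero_left times_complex.sel(2))
  then have "t * Im (w * cnj u) * Im (v * cnj u) = 0"
    by simp
  then show False using pos(2) vu by (metis less_irrefl mult_eq_0_iff)
qed

lemma framed_periodic_mem:
  assumes "framed_periodic a b m t u v w"
  shows "framed_triangle m t u v w \<in> three_periodics a b"
proof -
  have f: "frame u v w t" using assms by (simp add: framed_periodic_def)
  note f2 = frame_cycle [OF f]
  note f3 = frame_cycle [OF f2]
  have "line_dir (pt z) (pt (of_real k * ellipse_grad a b z)) = line_dir (pt z) (pt (ellipse_grad a b z))"
    if "k \<noteq> 0" for k z
    unfolding pt_of_real_mult by (rule line_dir_scaleR [OF that])
  then have "ellipse_normal a b (pt z) = line_dir (pt z) (pt d) \<and> pt z \<in> billiard_ellipse a b"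
    if "z \<bullet> ellipse_grad a b z = 1 \<and> (\<exists>k. k \<noteq> 0 \<and> d = of_real k * ellipse_grad a b z)" for z d
    using that by (auto simp: ellipse_normal_pt pt_in_billiard_ellipse)
  then show ?thesis
    using assms frame_not_collinear [OF f, of m]
    unfolding three_periodics_def framed_triangle_def framed_periodic_def
    by (simp add: bisectors_framed(1) [OF f] bisectors_framed(1) [OF f2] bisectors_framed(1) [OF f3]
        pt_in_billiard_ellipse)
qed

text \<open>A quarter turn interchanges the axes of the ellipse, so a construction with apex on one
  axis serves for the other as well.\<close>

lemma framed_periodic_rotate:
  assumes "framed_periodic b a m t u v w"
  shows "framed_periodic a b (- \<i> * m) t (- \<i> * u) (- \<i> * v) (- \<i> * w)"
proof -
  have grad: "ellipse_grad a b (- \<i> * z) = - \<i> * ellipse_grad b a z" for z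
    by (simp add: complex_eq_iff)
  have inner: "(- \<i> * z) \<bullet> (- \<i> * z') = z \<bullet> z'" for z z'
    by (simp add: inner_complex_def)
  have corner: "corner (- \<i> * m) t (- \<i> * p) (- \<i> * q) (- \<i> * s) = - \<i> * corner m t p q s" for p q s
    by (simp add: corner_def algebra_simps)
  have diff: "- \<i> * p - - \<i> * q = - \<i> * (p - q)" for p q
    by (simp add: algebra_simps)
  have im: "Im ((- \<i> * p) * cnj (- \<i> * q)) = Im (p * cnj q)" for p q
    by simp
  have frame: "frame (- \<i> * u) (- \<i> * v) (- \<i> * w) t \<longleftrightarrow> frame u v w t"
    unfolding frame_def im by (simp add: norm_mult)
  have scale: "- \<i> * d = of_real k * (- \<i> * z) \<longleftrightarrow> d = of_real k * z" for d k z
    by (simp add: mult.left_commute [of _ "\<i>"])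
  show ?thesis
    using assms unfolding framed_periodic_def frame corner diff
    unfolding ball_simps prod.case grad inner scale by simp
qed

text \<open>The apex is \<open>(0, b)\<close>, the base is horizontal, and \<open>x\<close> is the cosine of the base angles.\<close>

lemma isosceles_framed_periodic:
  assumes "0 < a" "0 < b" "0 < x" "x < 1" and x: "a\<^sup>2 * (1 - x\<^sup>2) = b\<^sup>2 * (x * (2 - x))"
  defines "R \<equiv> a\<^sup>2 / (2 * b * x)" and "y \<equiv> sqrt (1 - x\<^sup>2)"
  shows "framed_periodic a b (\<i> * of_real (b - R)) (- R) (Complex (- x) (- y)) 1 (Complex (- x) y)"
proof -
  have "R > 0" using assms by (simp add: R_def)
  have "x\<^sup>2 < 1" using assms by (simp add: power_less_one_iff)
  then have "0 < y" and y: "y\<^sup>2 = 1 - x\<^sup>2" by (simp_all add: y_def)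
  then have yy: "y * y = 1 - x * x" by (simp add: power2_eq_square)
  \<comment> \<open>The equation for \<open>x\<close> puts the base corners on the ellipse; the
    value of \<open>R\<close> gives the gradient there its horizontal coordinate,
    \<open>y / b\<close> up to sign.\<close>
  have R: "2 * R * y\<^sup>2 = b * (2 - x)"
    using x assms unfolding R_def y by (simp add: field_simps power2_eq_square)
  have R': "2 * R * x / a\<^sup>2 = 1 / b"
    using assms by (simp add: R_def)
  have frame: "frame (Complex (- x) (- y)) 1 (Complex (- x) y) (- R)"
    using \<open>R > 0\<close> \<open>0 < y\<close> \<open>0 < x\<close> y
    by (auto simp: frame_def cmod_def intro!: mult_pos_pos)
  have R1: "R * (x * x) = R - R * (y * y)" and R2: "2 * (R * (y * y)) = b * (2 - x)"
    using R unfolding yy by (simp_all add: algebra_simps power2_eq_square yy)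
  have A: "corner (\<i> * of_real (b - R)) (- R) (Complex (- x) y) (Complex (- x) (- y)) 1 = Complex 0 b"
    using R1 by (simp add: corner_def complex_eq_iff algebra_simps)
  have B: "corner (\<i> * of_real (b - R)) (- R) (Complex (- x) (- y)) 1 (Complex (- x) y) = Complex (- (2 * R * x * y)) (- (b * (1 - x)))"
    using R1 R2 by (simp add: corner_def complex_eq_iff algebra_simps)
  have C: "corner (\<i> * of_real (b - R)) (- R) 1 (Complex (- x) y) (Complex (- x) (- y)) = Complex (2 * R * x * y) (- (b * (1 - x)))"
    using R1 R2 by (simp add: corner_def complex_eq_iff algebra_simps)
  have gA: "ellipse_grad a b (Complex 0 b) = Complex 0 (1 / b)"
    and gB: "ellipse_grad a b (Complex (- (2 * R * x * y)) (- (b * (1 - x)))) = Complex (- y / b) (- ((1 - x) / b))"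
    and gC: "ellipse_grad a b (Complex (2 * R * x * y) (- (b * (1 - x)))) = Complex (y / b) (- ((1 - x) / b))"
  proof -
    have "2 * R * x * y / a\<^sup>2 = y / b"
      using arg_cong [OF R', of "\<lambda>r. r * y"] by simp
    then show "ellipse_grad a b (Complex (- (2 * R * x * y)) (- (b * (1 - x)))) = Complex (- y / b) (- ((1 - x) / b))"
      "ellipse_grad a b (Complex (2 * R * x * y) (- (b * (1 - x)))) = Complex (y / b) (- ((1 - x) / b))"
      using \<open>0 < b\<close> by (simp_all add: complex_eq_iff power2_eq_square)
  qed (use \<open>0 < b\<close> in \<open>simp add: complex_eq_iff power2_eq_square\<close>)
  have "2 * R * x * y * (y / b) = x * (2 * (R * (y * y))) / b"
    by simp
  also have "\<dots> = x * (2 - x)"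
    unfolding R2 using \<open>0 < b\<close> by simp
  finally have "2 * R * x * y * (y / b) = x * (2 - x)" .
  moreover have "b * (1 - x) * ((1 - x) / b) = (1 - x) * (1 - x)"
    using \<open>0 < b\<close> by simp
  ultimately have on: "2 * R * x * y * (y / b) + b * (1 - x) * ((1 - x) / b) = 1"
    by (simp only:) (simp add: algebra_simps)
  \<comment> \<open>Read off from the horizontal coordinates of bisector and normal at a base
    corner; the vertical ones then agree by \<open>(1 + x) (1 - x) = y\<^sup>2\<close>.\<close>
  define k where "k = - (b * (1 + x) / y)"
  have "(1 + x) * (1 - x) = y * y"
    unfolding yy by (simp add: algebra_simps)
  then have k: "k * ((1 - x) / b) = - y"
    using \<open>0 < b\<close> \<open>0 < y\<close> by (simp add: k_def)
  have k': "k * (y / b) = - (1 + x)"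
    using \<open>0 < b\<close> \<open>0 < y\<close> by (simp add: k_def)
  have "k \<noteq> 0"
    using \<open>0 < b\<close> \<open>0 < y\<close> \<open>0 < x\<close> by (simp add: k_def)
  have "Complex (- x) (- y) - Complex (- x) y = of_real (- (2 * y * b)) * Complex 0 (1 / b)"
    "1 - Complex (- x) (- y) = of_real k * Complex (- y / b) (- ((1 - x) / b))"
    "Complex (- x) y - 1 = of_real k * Complex (y / b) (- ((1 - x) / b))"
    using k k' \<open>0 < b\<close> by (simp_all add: complex_eq_iff)
  moreover have "- (2 * y * b) \<noteq> 0"
    using \<open>0 < b\<close> \<open>0 < y\<close> by simp
  moreover have "Complex 0 b \<bullet> Complex 0 (1 / b) = 1"
    "Complex (- (2 * R * x * y)) (- (b * (1 - x))) \<bullet> Complex (- y / b) (- ((1 - x) / b)) = 1"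
    "Complex (2 * R * x * y) (- (b * (1 - x))) \<bullet> Complex (y / b) (- ((1 - x) / b)) = 1"
    using on \<open>0 < b\<close> by (simp_all add: inner_complex_def)
  ultimately show ?thesis
    using frame \<open>k \<noteq> 0\<close> unfolding framed_periodic_def A B C ball_simps prod.case gA gB gC by blast
qed

text \<open>Right side minus left side is \<open>- a\<^sup>2\<close> at 0 and
  \<open>b\<^sup>2\<close> at 1.\<close>

lemma isosceles_parameter_exists:
  assumes "0 < (a::real)" "0 < b"
  obtains x where "0 < x" "x < 1" "a\<^sup>2 * (1 - x\<^sup>2) = b\<^sup>2 * (x * (2 - x))"
proof -
  define f where "f x = b\<^sup>2 * (x * (2 - x)) - a\<^sup>2 * (1 - x\<^sup>2)" for x
  have "\<exists>x. 0 \<le> x \<and> x \<le> 1 \<and> f x = 0"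
    by (rule IVT') (auto simp: f_def intro!: continuous_intros)
  then obtain x where "0 \<le> x" "x \<le> 1" "f x = 0" by blast
  moreover have "f 0 \<noteq> 0" "f 1 \<noteq> 0"
    using assms by (simp_all add: f_def)
  ultimately show ?thesis
    using that [of x] by (metis diff_eq_eq add.left_neutral f_def order_le_less)
qed

text \<open>Equal radii mean \<open>a ^ 3 (1 - x) = b ^ 3 x\<close>. Combined with the equation for
  \<open>x\<close> this gives \<open>a (2 - x) = b (1 + x)\<close>; eliminating \<open>a\<close> and
  \<open>b\<close> leaves \<open>(1 - 2 x) ^ 3 = 0\<close>, and \<open>x = 1 / 2\<close> would make
  \<open>a = b\<close>.\<close>

lemma isosceles_circumradii_differ:
  fixes a b x :: real
  assumes "0 < b" "b < a" "0 < x" "x < 1" and x: "a\<^sup>2 * (1 - x\<^sup>2) = b\<^sup>2 * (x * (2 - x))"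
  shows "a\<^sup>2 / (2 * b * x) \<noteq> b\<^sup>2 / (2 * a * (1 - x))"
proof
  assume "a\<^sup>2 / (2 * b * x) = b\<^sup>2 / (2 * a * (1 - x))"
  then have eq: "a ^ 3 * (1 - x) = b ^ 3 * x"
    using assms by (simp add: field_simps power2_eq_square power3_eq_cube)
  have "a\<^sup>2 * b\<^sup>2 * x * (1 - x) * (a * (2 - x)) = (a ^ 3 * (1 - x)) * (b\<^sup>2 * (x * (2 - x)))"
    by (simp add: power2_eq_square power3_eq_cube algebra_simps)
  also have "\<dots> = (b ^ 3 * x) * (a\<^sup>2 * (1 - x\<^sup>2))"
    unfolding eq x ..
  also have "\<dots> = a\<^sup>2 * b\<^sup>2 * x * (1 - x) * (b * (1 + x))"
    by (simp add: power2_eq_square power3_eq_cube algebra_simps)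
  finally have ratio: "a * (2 - x) = b * (1 + x)"
    using assms(1-4) unfolding mult_cancel_left by simp
  have "b\<^sup>2 * ((1 + x)\<^sup>2 * (1 - x\<^sup>2)) = (a * (2 - x))\<^sup>2 * (1 - x\<^sup>2)"
    unfolding ratio by (simp add: power_mult_distrib)
  also have "\<dots> = (2 - x)\<^sup>2 * (b\<^sup>2 * (x * (2 - x)))"
    unfolding x [symmetric] by (simp add: power_mult_distrib)
  also have "\<dots> = b\<^sup>2 * ((2 - x)\<^sup>2 * (x * (2 - x)))"
    by simp
  finally have "(1 + x)\<^sup>2 * (1 - x\<^sup>2) = (2 - x)\<^sup>2 * (x * (2 - x))"
    using assms(1) unfolding mult_cancel_left by simp
  then have "(1 - 2 * x) ^ 3 = 0"
    by (simp add: power2_eq_square power3_eq_cube algebra_simps)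
  then have "x = 1 / 2" by simp
  with ratio \<open>b < a\<close> show False by simp
qed

subsection \<open>Invariance of the ratio\<close>

text \<open>Subtracting the equations leaves \<open>p - q\<close> times a positive factor. Hence all
  3-periodics of one billiard share the same \<open>Q\<close>.\<close>

lemma billiard_invariant_unique:
  fixes p q c d :: real
  assumes "(3 - p\<^sup>2) * c = 2 * p * d" "(3 - q\<^sup>2) * c = 2 * q * d" "0 < p" "0 < q" "0 < c" "0 < d"
  shows "p = q"
proof -
  have "(p - q) * ((p + q) * c + 2 * d) = 0"
    using assms(1,2) by (simp add: power2_eq_square algebra_simps)
  moreover have "(p + q) * c + 2 * d > 0"
    using assms by (simp add: add_pos_pos)
  ultimately show ?thesis by simp
qed

lemma mu_three_periodic:
  assumes "0 < b" "b < a" and T: "T \<in> three_periodics a b"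
  obtains Q where "0 < Q" "Q < 1" "(3 - Q\<^sup>2) * (a\<^sup>2 - b\<^sup>2) = 2 * Q * (a\<^sup>2 + b\<^sup>2)"
    "0 < circumradius T" "inradius T = circumradius T * (1 - Q\<^sup>2) / 2"
    "mu_major T = circumradius T * (1 + Q)" "mu_minor T = circumradius T * (1 - Q)"
    "\<exists>!K. is_inconic (excentral T) (circumcenter (excentral T)) K" "is_ellipse (excentral_inconic T)"
proof -
  obtain m t u v w Q where T_eq: "T = framed_triangle m t u v w" and f: "frame u v w t" and Q: "0 < Q" "Q < 1"
    and rel: "side_relation Q u v" "side_relation Q v w" "side_relation Q w u"
    and h: "(cmod (u + v + w))\<^sup>2 = Q\<^sup>2" and inv: "(3 - Q\<^sup>2) * (a\<^sup>2 - b\<^sup>2) = 2 * Q * (a\<^sup>2 + b\<^sup>2)"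
    using three_periodic_framed [OF assms] by metis
  have R: "circumradius T = \<bar>t\<bar>" "0 < circumradius T"
    using circumcenter_framed(2) [OF f, of m] frame_distinct(7) [OF f] by (simp_all add: T_eq)
  have "Q\<^sup>2 < 1" using Q by (simp add: power_less_one_iff)
  have "inradius T = circumradius T * (1 - Q\<^sup>2) / 2"
    unfolding R(1) unfolding T_eq inradius_framed [OF f] h using \<open>Q\<^sup>2 < 1\<close> by (simp add: abs_mult)
  moreover note semi = semiaxes_framed [OF f Q rel, of m]
  then have "mu_major T = circumradius T * (1 + Q)" "mu_minor T = circumradius T * (1 - Q)"
    unfolding mu_major_def mu_minor_def R unfolding T_eq by (simp_all add: semiaxes_eq)
  moreover have "is_ellipse (excentral_inconic T)"
    using semi unfolding is_ellipse_def T_eq by blast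
  moreover have "\<exists>!K. is_inconic (excentral T) (circumcenter (excentral T)) K"
    unfolding T_eq using Q by (subst is_inconic_excentral_framed [OF f _ rel]) simp_all
  ultimately show ?thesis
    using that Q R(2) inv by simp
qed

lemma circumradius_varies:
  assumes "0 < b" "b < a"
  obtains S T where "S \<in> three_periodics a b" "T \<in> three_periodics a b" "circumradius S \<noteq> circumradius T"
proof -
  have "0 < a" using assms by simp
  obtain x where x: "0 < x" "x < 1" "a\<^sup>2 * (1 - x\<^sup>2) = b\<^sup>2 * (x * (2 - x))"
    using isosceles_parameter_exists [OF \<open>0 < a\<close> assms(1)] .
  \<comment> \<open>The equation for \<open>x\<close> is preserved when \<open>a\<close>,
    \<open>b\<close> are swapped and \<open>x\<close> becomes \<open>1 - x\<close>, so one root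
    serves both isosceles triangles.\<close>
  then have x': "0 < 1 - x" "1 - x < 1" "b\<^sup>2 * (1 - (1 - x)\<^sup>2) = a\<^sup>2 * ((1 - x) * (2 - (1 - x)))"
    by (simp_all add: power2_eq_square algebra_simps)
  have circumradius: "circumradius (framed_triangle m t u v w) = \<bar>t\<bar>" if "framed_periodic a b m t u v w" for m t u v w
    using that circumcenter_framed(2) by (simp add: framed_periodic_def)
  note S = isosceles_framed_periodic [OF \<open>0 < a\<close> assms(1) x]
  note T = framed_periodic_rotate [OF isosceles_framed_periodic [OF assms(1) \<open>0 < a\<close> x']]
  have "\<bar>- (a\<^sup>2 / (2 * b * x))\<bar> \<noteq> \<bar>- (b\<^sup>2 / (2 * a * (1 - x)))\<bar>"
    using isosceles_circumradii_differ [OF assms x] assms(1) \<open>0 < a\<close> x(1,2) by (simp add: abs_of_pos)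
  then show ?thesis
    using that [OF framed_periodic_mem [OF S] framed_periodic_mem [OF T]]
    unfolding circumradius [OF S] circumradius [OF T] by blast
qed

theorem theorem3:
  fixes a b :: real
  assumes "b > 0" and "a > b"
  shows
    "(\<forall>T \<in> three_periodics a b.
        (\<exists>!K. is_inconic (excentral T) (circumcenter (excentral T)) K)
        \<and> is_ellipse (excentral_inconic T))
     \<and> \<not> mu_major constant_on three_periodics a b
     \<and> \<not> mu_minor constant_on three_periodics a b
     \<and> (\<lambda>T. mu_major T / mu_minor T) constant_on three_periodics a b
     \<and> (\<forall>T \<in> three_periodics a b.
          let r = inradius T; R = circumradius T; \<rho> = r / R; d = sqrt (R * (R - 2 * r))
          in mu_major T = R + d
             \<and> mu_minor T = R - d
             \<and> mu_major T / mu_minor T = (R + d) / (R - d)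
             \<and> (R + d) / (R - d) = (1 + sqrt (1 - 2 * \<rho>)) / \<rho> - 1
             \<and> (1 + sqrt (1 - 2 * \<rho>)) / \<rho> - 1 > 1)"
proof -
  have "b\<^sup>2 < a\<^sup>2"
    using assms by (intro power_strict_mono) auto
  then have pos: "0 < a\<^sup>2 - b\<^sup>2" "0 < a\<^sup>2 + b\<^sup>2"
    using assms by (simp_all add: add_nonneg_pos)
  obtain S\<^sub>1 S\<^sub>2 where S: "S\<^sub>1 \<in> three_periodics a b" "S\<^sub>2 \<in> three_periodics a b"
    and R_neq: "circumradius S\<^sub>1 \<noteq> circumradius S\<^sub>2"
    by (rule circumradius_varies [OF assms])
  obtain Q where Q: "0 < Q" "Q < 1" "(3 - Q\<^sup>2) * (a\<^sup>2 - b\<^sup>2) = 2 * Q * (a\<^sup>2 + b\<^sup>2)"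
    by (rule mu_three_periodic [OF assms S(1)])
  \<comment> \<open>The \<open>Q\<close> taken from \<open>S\<^sub>1\<close> is that of every
    3-periodic, by uniqueness of the positive root.\<close>
  have mu: "0 < circumradius T" "inradius T = circumradius T * (1 - Q\<^sup>2) / 2"
      "mu_major T = circumradius T * (1 + Q)" "mu_minor T = circumradius T * (1 - Q)"
      "\<exists>!K. is_inconic (excentral T) (circumcenter (excentral T)) K" "is_ellipse (excentral_inconic T)"
    if "T \<in> three_periodics a b" for T
    using mu_three_periodic [OF assms that] billiard_invariant_unique [OF Q(3) _ Q(1) _ pos] by metis+
  have ratio: "mu_major T / mu_minor T = (1 + Q) / (1 - Q)" if "T \<in> three_periodics a b" for T
    using mu(1,3,4) [OF that] by simp
  have "mu_major S\<^sub>1 \<noteq> mu_major S\<^sub>2" "mu_minor S\<^sub>1 \<noteq> mu_minor S\<^sub>2"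
    using R_neq Q(1,2) mu(3,4) [OF S(1)] mu(3,4) [OF S(2)] by simp_all
  then have "\<not> mu_major constant_on three_periodics a b" "\<not> mu_minor constant_on three_periodics a b"
    using S unfolding constant_on_def by metis+
  moreover have "(\<lambda>T. mu_major T / mu_minor T) constant_on three_periodics a b"
    unfolding constant_on_def using ratio by blast
  moreover have "let r = inradius T; R = circumradius T; \<rho> = r / R; d = sqrt (R * (R - 2 * r))
      in mu_major T = R + d \<and> mu_minor T = R - d \<and> mu_major T / mu_minor T = (R + d) / (R - d)
       \<and> (R + d) / (R - d) = (1 + sqrt (1 - 2 * \<rho>)) / \<rho> - 1
       \<and> (1 + sqrt (1 - 2 * \<rho>)) / \<rho> - 1 > 1" if T: "T \<in> three_periodics a b" for T
  proof -
    define R where "R = circumradius T"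
    have "0 < R" and r: "inradius T = R * (1 - Q\<^sup>2) / 2"
      using mu(1,2) [OF T] by (simp_all add: R_def)
    \<comment> \<open>Euler's formula: \<open>R Q\<close> is the distance between circumcenter and
      incenter.\<close>
    have "R * (R - 2 * inradius T) = (R * Q)\<^sup>2"
      unfolding r by (simp add: power2_eq_square field_simps)
    then have d: "sqrt (R * (R - 2 * inradius T)) = R * Q"
      using \<open>0 < R\<close> Q(1) by simp
    have \<rho>: "inradius T / R = (1 - Q\<^sup>2) / 2"
      unfolding r using \<open>0 < R\<close> by simp
    have sqrt: "sqrt (1 - 2 * (inradius T / R)) = Q"
      unfolding \<rho> using Q(1) by (simp add: diff_divide_distrib)
    \<comment> \<open>Written as a product so that \<open>1 + Q\<close> cancels in the quotient by
      \<open>\<rho>\<close>.\<close>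
    have factor: "(1 - Q\<^sup>2) / 2 = (1 + Q) * ((1 - Q) / 2)"
      by (simp add: power2_eq_square algebra_simps)
    have "1 + Q \<noteq> 0" using Q(1) by simp
    then have cancel: "(1 + Q) / ((1 + Q) * c) = 1 / c" for c
      by (rule nonzero_divide_mult_cancel_left)
    have "(1 + Q) / ((1 - Q\<^sup>2) / 2) - 1 = 2 / (1 - Q) - 1"
      unfolding factor cancel by simp
    also have "\<dots> = (1 + Q) / (1 - Q)"
      using Q by (simp add: field_simps)
    finally have e: "(1 + Q) / ((1 - Q\<^sup>2) / 2) - 1 = (1 + Q) / (1 - Q)" .
    have "R + R * Q = R * (1 + Q)" "R - R * Q = R * (1 - Q)"
      by (simp_all add: algebra_simps)
    moreover have "1 < (1 + Q) / (1 - Q)"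
      using Q by simp
    ultimately show ?thesis
      using mu(3,4) [OF T] \<open>0 < R\<close>
      unfolding Let_def R_def [symmetric] d sqrt unfolding \<rho> e by simp
  qed
  ultimately show ?thesis
    using mu(5,6) by blast
qed

end
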